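(* Let $1\le q\le\infty$ and assume that $(v_\lambda)$ or $(\omega_\lambda)$ is bounded away from $0$. In case $(v_\lambda)$ is not bounded away from $0$, assume further that there is a constant $c>0$ such that $v_\lambda<c$ for only finitely many $\lambda$. Then for any $u^{(0)}\in\ell_2(\Lambda,\mathbb{R}^M)$ the sequence $$u^{(m+1)}=U^{(q)}_{v,\omega}\big(u^{(m)}+T^*(g-Tu^{(m)})\big)$$ converges strongly in $\ell_2(\Lambda,\mathbb{R}^M)$ to a minimizer of $K(u)=\|Tu-g\|_{\mathcal{H}}^2+\Psi^{(q)}_{v,\omega}(u)$.
   Context: $\Lambda$ is a countable index set, $M\in\mathbb{N}$, and $\ell_2(\Lambda,\mathbb{R}^M)$ is the real Hilbert space of families $u=(u_\lambda)_{\lambda\in\Lambda}$, $u_\lambda\in\mathbb{R}^M$, with $\|u\|_2^2=\sum_\lambda\|u_\lambda\|_2^2<\infty$. $\mathcal{H}$ is a separable real Hilbert space, $g\in\mathcal{H}$, and $T:\ell_2(\Lambda,\mathbb{R}^M)\to\mathcal{H}$ is a bounded linear operator with $\|T\|<1$. $v=(v_\lambda)_{\lambda\in\Lambda}$ and $\omega=(\omega_\lambda)_{\lambda\in\Lambda}$ are sequences of non-negative numbers, $\|\cdot\|_q$ is the $\ell_q$-norm on $\mathbb{R}^M$, and $$\Psi^{(q)}_{v,\omega}(u)=\sum_{\lambda\in\Lambda}v_\lambda\|u_\lambda\|_q+\sum_{\lambda\in\Lambda}\omega_\lambda\|u_\lambda\|_2^2\in[0,\infty],\qquad U^{(q)}_{v,\omega}(u)=\arg\min_{z\in\ell_2(\Lambda,\mathbb{R}^M)}\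 \|u-z\|_2^2+\Psi^{(q)}_{v,\omega}(z).$$ Standing assumption: $K$ is strictly convex (which is ensured, for instance, if $\ker T=\{0\}$ or $\omega_\lambda>0$ for all $\lambda$). *)

theory Defs
  imports "HOL-Analysis.Analysis"
begin

section \<open>The Hilbert space of square-summable families\<close>

text \<open>
  The index set is a whole type, and \<open>('l, 'b) ell2\<close> consists of the square-summable families
  \<open>(u\<^sub>l)\<close> with entries in an arbitrary real inner product space \<open>'b\<close>.
\<close>

typedef (overloaded) ('l, 'b) ell2 =
  "{u :: 'l \<Rightarrow> 'b::real_inner. (\<lambda>l. (norm (u l))\<^sup>2) summable_on UNIV}"
  morphisms ell2_nth ell2_abs
  by (rule exI[of _ "\<lambda>_. 0"]) simp

setup_lifting type_definition_ell2

lemma ell2_eqI: "(\<And>l. ell2_nth x l = ell2_nth y l) \<Longrightarrow> x = y"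
  by (rule iffD1[OF ell2_nth_inject]) (rule ext)

lemma ell2_summable: "(\<lambda>l. (norm (ell2_nth x l))\<^sup>2) summable_on UNIV"
  using ell2_nth[of x] by simp

lemma norm_add_power2_le:
  fixes a b :: "'b::real_inner"
  shows "(norm (a + b))\<^sup>2 \<le> 2 * (norm a)\<^sup>2 + 2 * (norm b)\<^sup>2"
proof -
  have "(norm (a + b))\<^sup>2 + (norm (a - b))\<^sup>2 = 2 * (norm a)\<^sup>2 + 2 * (norm b)\<^sup>2"
    by (simp add: power2_norm_eq_inner algebra_simps inner_commute)
  then show ?thesis
    using zero_le_power2[of "norm (a - b)"] by linarith
qed

lemma ell2_add_summable:
  fixes f g :: "'l \<Rightarrow> 'b::real_inner"
  assumes "(\<lambda>l. (norm (f l))\<^sup>2) summable_on UNIV" "(\<lambda>l. (norm (g l))\<^sup>2) summable_on UNIV"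
  shows "(\<lambda>l. (norm (f l + g l))\<^sup>2) summable_on UNIV"
proof (rule summable_on_comparison_test)
  show "(\<lambda>l. 2 * (norm (f l))\<^sup>2 + 2 * (norm (g l))\<^sup>2) summable_on UNIV"
    by (intro summable_on_add summable_on_cmult_right assms)
qed (simp_all add: norm_add_power2_le)

lemma ell2_scale_summable:
  fixes f :: "'l \<Rightarrow> 'b::real_inner"
  assumes "(\<lambda>l. (norm (f l))\<^sup>2) summable_on UNIV"
  shows "(\<lambda>l. (norm (r *\<^sub>R f l))\<^sup>2) summable_on UNIV"
  using summable_on_cmult_right[OF assms, of "r\<^sup>2"] by (simp add: power_mult_distrib)

instantiation ell2 :: (type, real_inner) real_vector
begin

lift_definition zero_ell2 :: "('a, 'b) ell2" is "\<lambda>_. 0" by simp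

lift_definition plus_ell2 :: "('a, 'b) ell2 \<Rightarrow> ('a, 'b) ell2 \<Rightarrow> ('a, 'b) ell2"
  is "\<lambda>u v l. u l + v l" by (rule ell2_add_summable)

lift_definition uminus_ell2 :: "('a, 'b) ell2 \<Rightarrow> ('a, 'b) ell2"
  is "\<lambda>u l. - u l" by simp

lift_definition scaleR_ell2 :: "real \<Rightarrow> ('a, 'b) ell2 \<Rightarrow> ('a, 'b) ell2"
  is "\<lambda>r u l. r *\<^sub>R u l" by (rule ell2_scale_summable)

definition minus_ell2 :: "('a, 'b) ell2 \<Rightarrow> ('a, 'b) ell2 \<Rightarrow> ('a, 'b) ell2"
  where "minus_ell2 u v = u + - v"

instance
proof
  fix x y z :: "('a, 'b) ell2" and a b :: real
  show "x + y + z = x + (y + z)" by transfer (simp add: add.assoc)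
  show "x + y = y + x" by transfer (simp add: add.commute)
  show "0 + x = x" by transfer simp
  show "- x + x = 0" by transfer simp
  show "x - y = x + - y" by (rule minus_ell2_def)
  show "a *\<^sub>R (x + y) = a *\<^sub>R x + a *\<^sub>R y" by transfer (simp add: scaleR_add_right)
  show "(a + b) *\<^sub>R x = a *\<^sub>R x + b *\<^sub>R x" by transfer (simp add: scaleR_add_left)
  show "a *\<^sub>R b *\<^sub>R x = (a * b) *\<^sub>R x" by transfer simp
  show "1 *\<^sub>R x = x" by transfer simp
qed

end

lemma ell2_nth_zero [simp]: "ell2_nth 0 l = 0"
  by transfer simp

lemma ell2_nth_add [simp]: "ell2_nth (x + y) l = ell2_nth x l + ell2_nth y l"
  by transfer simp

lemma ell2_nth_uminus [simp]: "ell2_nth (- x) l = - ell2_nth x l"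
  by transfer simp

lemma ell2_nth_scaleR [simp]: "ell2_nth (r *\<^sub>R x) l = r *\<^sub>R ell2_nth x l"
  by transfer simp

lemma ell2_nth_diff [simp]: "ell2_nth (x - y) l = ell2_nth x l - ell2_nth y l"
  by (simp only: minus_ell2_def ell2_nth_add ell2_nth_uminus) simp

lemma ell2_inner_summable:
  "(\<lambda>l. inner (ell2_nth x l) (ell2_nth y l)) summable_on UNIV"
proof -
  have eq: "inner (ell2_nth x l) (ell2_nth y l) =
      (1/2) * (norm (ell2_nth (x + y) l))\<^sup>2 +
      (- 1/2) * ((norm (ell2_nth x l))\<^sup>2 + (norm (ell2_nth y l))\<^sup>2)" for l
    by (simp add: power2_norm_eq_inner inner_add_left inner_add_right inner_commute algebra_simps)
  show ?thesis
    unfolding eq by (intro summable_on_add summable_on_cmult_right ell2_summable)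
qed

instantiation ell2 :: (type, real_inner) real_inner
begin

definition inner_ell2 :: "('a, 'b) ell2 \<Rightarrow> ('a, 'b) ell2 \<Rightarrow> real"
  where "inner_ell2 x y = (\<Sum>\<^sub>\<infinity>l. inner (ell2_nth x l) (ell2_nth y l))"

definition norm_ell2 :: "('a, 'b) ell2 \<Rightarrow> real"
  where "norm_ell2 x = sqrt (\<Sum>\<^sub>\<infinity>l. (norm (ell2_nth x l))\<^sup>2)"

definition sgn_ell2 :: "('a, 'b) ell2 \<Rightarrow> ('a, 'b) ell2"
  where "sgn_ell2 x = x /\<^sub>R norm x"

definition dist_ell2 :: "('a, 'b) ell2 \<Rightarrow> ('a, 'b) ell2 \<Rightarrow> real"
  where "dist_ell2 x y = norm (x - y)"

definition uniformity_ell2 :: "(('a, 'b) ell2 \<times> ('a, 'b) ell2) filter"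
  where "uniformity_ell2 = (INF e\<in>{0 <..}. principal {(x, y). dist x y < e})"

definition open_ell2 :: "('a, 'b) ell2 set \<Rightarrow> bool"
  where "open_ell2 S = (\<forall>x\<in>S. \<forall>\<^sub>F (x', y) in uniformity. x' = x \<longrightarrow> y \<in> S)"

instance
proof
  fix x y z :: "('a, 'b) ell2" and r :: real
  show "inner x y = inner y x"
    by (simp add: inner_ell2_def inner_commute)
  show "inner (x + y) z = inner x z + inner y z"
    by (simp add: inner_ell2_def inner_add_left infsum_add ell2_inner_summable)
  show "inner (r *\<^sub>R x) y = r * inner x y"
    by (simp add: inner_ell2_def infsum_cmult_right')
  show "0 \<le> inner x x"
    by (simp add: inner_ell2_def infsum_nonneg)
  show "inner x x = 0 \<longleftrightarrow> x = 0"
  proof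
    assume "inner x x = 0"
    then have "inner (ell2_nth x l) (ell2_nth x l) = 0" for l
      using nonneg_infsum_le_0D[of "\<lambda>l. inner (ell2_nth x l) (ell2_nth x l)" UNIV l]
        ell2_inner_summable[of x x]
      by (simp add: inner_ell2_def)
    then show "x = 0"
      by (intro ell2_eqI) simp
  qed (simp add: inner_ell2_def)
  show "norm x = sqrt (inner x x)"
    by (simp add: norm_ell2_def inner_ell2_def power2_norm_eq_inner)
qed (simp_all add: sgn_ell2_def dist_ell2_def uniformity_ell2_def open_ell2_def)

end

lemma ell2_norm_power2: "(norm x)\<^sup>2 = (\<Sum>\<^sub>\<infinity>l. (norm (ell2_nth x l))\<^sup>2)"
  by (simp add: norm_ell2_def infsum_nonneg)

lemma ell2_sum_le_norm_power2:
  assumes "finite F"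
  shows "(\<Sum>l\<in>F. (norm (ell2_nth x l))\<^sup>2) \<le> (norm x)\<^sup>2"
  unfolding ell2_norm_power2
  by (rule finite_sum_le_infsum) (use assms ell2_summable in auto)

lemma ell2_norm_nth_le: "norm (ell2_nth x l) \<le> norm x"
  using ell2_sum_le_norm_power2[of "{l}" x] by simp

instance ell2 :: (type, "{real_inner, complete_space}") complete_space
proof
  fix X :: "nat \<Rightarrow> ('a, 'b) ell2"
  assume X: "Cauchy X"
  have "Cauchy (\<lambda>n. ell2_nth (X n) l)" for l
  proof (rule metric_CauchyI)
    fix e :: real assume "e > 0"
    then obtain N where N: "\<And>m n. m \<ge> N \<Longrightarrow> n \<ge> N \<Longrightarrow> dist (X m) (X n) < e"
      using metric_CauchyD[OF X] by blast
    have "dist (ell2_nth (X m) l) (ell2_nth (X n) l) \<le> dist (X m) (X n)" for m n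
      using ell2_norm_nth_le[of "X m - X n" l] by (simp add: dist_norm)
    with N show "\<exists>M. \<forall>m\<ge>M. \<forall>n\<ge>M. dist (ell2_nth (X m) l) (ell2_nth (X n) l) < e"
      by (meson order_le_less_trans)
  qed
  then have "\<exists>a. (\<lambda>n. ell2_nth (X n) l) \<longlonglongrightarrow> a" for l
    by (simp add: Cauchy_convergent_iff convergent_def)
  then obtain f where f: "\<And>l. (\<lambda>n. ell2_nth (X n) l) \<longlonglongrightarrow> f l"
    by metis
  have fin: "(\<Sum>l\<in>F. (norm (ell2_nth (X m) l - f l))\<^sup>2) \<le> e\<^sup>2"
    if "finite F" "\<And>n. n \<ge> N \<Longrightarrow> dist (X m) (X n) < e" for F m N e
  proof (rule LIMSEQ_le_const2)
    show "(\<lambda>n. \<Sum>l\<in>F. (norm (ell2_nth (X m) l - ell2_nth (X n) l))\<^sup>2)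
        \<longlonglongrightarrow> (\<Sum>l\<in>F. (norm (ell2_nth (X m) l - f l))\<^sup>2)"
      by (intro tendsto_intros f)
    have "(\<Sum>l\<in>F. (norm (ell2_nth (X m) l - ell2_nth (X n) l))\<^sup>2) \<le> e\<^sup>2" if "n \<ge> N" for n
    proof -
      have "(\<Sum>l\<in>F. (norm (ell2_nth (X m - X n) l))\<^sup>2) \<le> (norm (X m - X n))\<^sup>2"
        by (rule ell2_sum_le_norm_power2) fact
      also have "\<dots> \<le> e\<^sup>2"
        using \<open>\<And>n. n \<ge> N \<Longrightarrow> dist (X m) (X n) < e\<close>[OF that]
        by (intro power_mono) (auto simp: dist_norm)
      finally show ?thesis by simp
    qed
    then show "\<exists>K. \<forall>n\<ge>K. (\<Sum>l\<in>F. (norm (ell2_nth (X m) l - ell2_nth (X n) l))\<^sup>2) \<le> e\<^sup>2"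
      by blast
  qed
  have sm: "(\<lambda>l. (norm (ell2_nth (X m) l - f l))\<^sup>2) summable_on UNIV"
    if "\<And>n. n \<ge> N \<Longrightarrow> dist (X m) (X n) < e" for m N e
    by (rule nonneg_bdd_above_summable_on)
      (use fin[OF _ that] in \<open>auto intro!: bdd_aboveI2\<close>)
  obtain N1 where N1: "\<And>m n. m \<ge> N1 \<Longrightarrow> n \<ge> N1 \<Longrightarrow> dist (X m) (X n) < 1"
    using metric_CauchyD[OF X, of 1] by force
  have "(\<lambda>l. (norm (ell2_nth (- X N1) l + (ell2_nth (X N1) l - f l)))\<^sup>2) summable_on UNIV"
    by (rule ell2_add_summable[OF ell2_summable sm[of N1]]) (use N1 in auto)
  then have "(\<lambda>l. (norm (f l))\<^sup>2) summable_on UNIV"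
    by simp
  then have nth: "ell2_nth (ell2_abs f) = f"
    by (simp add: ell2_abs_inverse)
  have "X \<longlonglongrightarrow> ell2_abs f"
  proof (rule metric_LIMSEQ_I)
    fix e :: real assume "e > 0"
    then obtain N where N: "\<And>m n. m \<ge> N \<Longrightarrow> n \<ge> N \<Longrightarrow> dist (X m) (X n) < e / 2"
      using metric_CauchyD[OF X, of "e/2"] by auto
    have "dist (X m) (ell2_abs f) < e" if "m \<ge> N" for m
    proof -
      have "(norm (X m - ell2_abs f))\<^sup>2 \<le> (e/2)\<^sup>2"
        unfolding ell2_norm_power2
        by (rule infsum_le_finite_sums[OF ell2_summable])
          (use fin[of _ N m "e/2"] N that nth in simp)
      then have "norm (X m - ell2_abs f) \<le> e / 2"
        using \<open>e > 0\<close> by (simp add: power2_le_iff_abs_le)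
      then show ?thesis
        using \<open>e > 0\<close> by (simp add: dist_norm)
    qed
    then show "\<exists>no. \<forall>n\<ge>no. dist (X n) (ell2_abs f) < e"
      by blast
  qed
  then show "convergent X"
    by (auto simp: convergent_def)
qed


section \<open>The functionals\<close>

definition lq_norm :: "ennreal \<Rightarrow> real ^ 'm \<Rightarrow> real"
  where "lq_norm q x =
    (if q = \<infinity> then Max (range (\<lambda>i. \<bar>x $ i\<bar>))
     else (\<Sum>i\<in>UNIV. \<bar>x $ i\<bar> powr enn2real q) powr (1 / enn2real q))"

text \<open>The sums below are taken in \<^typ>\<open>ennreal\<close>, so a divergent sum has the value \<open>\<infinity>\<close>.\<close>

definition Psi :: "ennreal \<Rightarrow> ('l \<Rightarrow> real) \<Rightarrow> ('l \<Rightarrow> real) \<Rightarrow> ('l, real ^ 'm) ell2 \<Rightarrow> ennreal"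
  where "Psi q v \<omega> u =
    (\<Sum>\<^sub>\<infinity>l. ennreal (v l * lq_norm q (ell2_nth u l))) +
    (\<Sum>\<^sub>\<infinity>l. ennreal (\<omega> l * (norm (ell2_nth u l))\<^sup>2))"

definition U_op ::
    "ennreal \<Rightarrow> ('l \<Rightarrow> real) \<Rightarrow> ('l \<Rightarrow> real) \<Rightarrow> ('l, real ^ 'm) ell2 \<Rightarrow> ('l, real ^ 'm) ell2"
  where "U_op q v \<omega> u = (ARG_MIN (\<lambda>z. ennreal ((norm (u - z))\<^sup>2) + Psi q v \<omega> z) z. True)"

definition K_fun ::
    "ennreal \<Rightarrow> ('l \<Rightarrow> real) \<Rightarrow> ('l \<Rightarrow> real) \<Rightarrow> (('l, real ^ 'm) ell2 \<Rightarrow> 'h::real_inner) \<Rightarrow> 'h \<Rightarrow>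
      ('l, real ^ 'm) ell2 \<Rightarrow> ennreal"
  where "K_fun q v \<omega> T g u = ennreal ((norm (T u - g))\<^sup>2) + Psi q v \<omega> u"

text \<open>
  Strict convexity of an extended-valued functional: the strict inequality is required on the
  effective domain (outside it the right-hand side is \<open>\<infinity>\<close>).
\<close>

definition strictly_convex :: "('a::real_vector \<Rightarrow> ennreal) \<Rightarrow> bool"
  where "strictly_convex F \<longleftrightarrow>
    (\<forall>x y t. x \<noteq> y \<longrightarrow> F x < \<infinity> \<longrightarrow> F y < \<infinity> \<longrightarrow> 0 < t \<longrightarrow> t < 1 \<longrightarrow>
      F ((1 - t) *\<^sub>R x + t *\<^sub>R y) < ennreal (1 - t) * F x + ennreal t * F y)"

definition bounded_away_from_0 :: "('l \<Rightarrow> real) \<Rightarrow> bool"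
  where "bounded_away_from_0 a \<longleftrightarrow> (\<exists>c>0. \<forall>l. c \<le> a l)"

end

theory Submission
  imports Defs
begin

text \<open>
  With \<open>L u = u + T\<^sup>* (g - T u)\<close> the iteration is \<open>u\<^sub>m\<^sub>+\<^sub>1 = U (L u\<^sub>m)\<close>, and the minimizers of the functional
  \<open>K\<close> are exactly the fixed points of \<open>U \<circ> L\<close>, by the variational inequalities of both minimization
  problems. Minimizers exist because \<open>K\<close> is convex, lower semicontinuous and coercive. For a
  minimizer \<open>z\<close>, firm nonexpansiveness of \<open>U\<close> makes \<open>\<parallel>u\<^sub>m - z\<parallel>\<close> decreasing and the residuals
  \<open>L u\<^sub>m - u\<^sub>m\<^sub>+\<^sub>1\<close> strongly convergent to \<open>L z - z\<close>. Where \<open>v\<^sub>l \<ge> c\<close>, a nonzero coordinate of \<open>u\<^sub>m\<^sub>+\<^sub>1\<close> forces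
  the corresponding coordinate of the residual to be larger than a fixed threshold, whereas only
  finitely many coordinates of \<open>L z - z\<close> are large. Hence the \<open>u\<^sub>m\<close> are eventually supported in one
  finite set, a subsequence converges strongly to a fixed point, and by the monotonicity of the
  distance to this fixed point so does the whole sequence.
\<close>

section \<open>Minimization and adjoints in Hilbert spaces\<close>

lemma norm_midpoint_power2:
  fixes x y :: "'a::real_inner"
  shows "(norm (x - y))\<^sup>2 = 2 * (norm x)\<^sup>2 + 2 * (norm y)\<^sup>2 - 4 * (norm ((1/2) *\<^sub>R x + (1/2) *\<^sub>R y))\<^sup>2"
  by (simp add: power2_norm_eq_inner inner_simps inner_commute algebra_simps)

text \<open>
  A substitute for weak compactness: points of almost minimal norm in the sets form a Cauchy
  sequence, by the parallelogram law.
\<close>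

lemma nested_closed_convex_bounded:
  fixes C :: "nat \<Rightarrow> 'a::{real_inner, complete_space} set"
  assumes dec: "\<And>n m. n \<le> m \<Longrightarrow> C m \<subseteq> C n" and ne: "\<And>n. C n \<noteq> {}"
    and cl: "\<And>n. closed (C n)" and cv: "\<And>n. convex (C n)" and bd: "bounded (C 0)"
  shows "\<exists>x. \<forall>n. x \<in> C n"
proof -
  define d where "d n = (INF x\<in>C n. (norm x)\<^sup>2)" for n
  have bdd: "bdd_below ((\<lambda>x. (norm x)\<^sup>2) ` C n)" for n
    by (rule bdd_belowI[of _ 0]) auto
  have d_le: "d n \<le> (norm x)\<^sup>2" if "x \<in> C n" for n x
    unfolding d_def by (rule cINF_lower[OF bdd that])
  have "\<exists>x\<in>C n. (norm x)\<^sup>2 < d n + 1 / real (Suc n)" for n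
    using cINF_less_iff[OF ne[of n] bdd[of n], of "d n + 1 / real (Suc n)"] by (simp add: d_def)
  then obtain x where x: "\<And>n. x n \<in> C n" "\<And>n. (norm (x n))\<^sup>2 < d n + 1 / real (Suc n)"
    by metis
  have xC: "x m \<in> C n" if "n \<le> m" for n m
    using x(1)[of m] dec[OF that] by blast
  have d_mono: "d n \<le> d m" if "n \<le> m" for n m
    unfolding d_def by (rule cINF_superset_mono[OF ne bdd dec[OF that]]) auto
  obtain B where B: "\<And>x. x \<in> C 0 \<Longrightarrow> norm x \<le> B"
    using bd by (auto simp: bounded_iff)
  have "d n \<le> B\<^sup>2" for n
    using d_le[OF x(1)[of n]] power_mono[OF B[OF xC[of 0 n]], of 2] by simp
  then obtain D where D: "d \<longlonglongrightarrow> D"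
    using incseq_convergent[of d "B\<^sup>2"] d_mono by (metis incseq_def)
  have d_le_D: "d n \<le> D" for n
    using D d_mono by (intro LIMSEQ_le_const) auto
  \<comment> \<open>\<open>x n\<close> and \<open>x m\<close> exceed \<open>d n\<close> and
    \<open>d m\<close> by at most \<open>1 / real (Suc n)\<close> each, while their midpoint stays
    in \<open>C n\<close>. The parallelogram law then leaves twice the gap \<open>d m - d n\<close>,
    at most \<open>D - d n\<close>, plus four times the slack.\<close>
  define r where "r n = 2 * (D - d n) + 4 * inverse (real (Suc n))" for n
  have diff: "(norm (x n - x m))\<^sup>2 \<le> r n" if "n \<le> m" for n m
  proof -
    have "(1/2) *\<^sub>R x n + (1/2) *\<^sub>R x m \<in> C n"
      using cv[of n] x(1)[of n] xC[OF that] by (intro convexD) auto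
    from d_le[OF this] have "(norm (x n - x m))\<^sup>2 \<le> 2 * (norm (x n))\<^sup>2 + 2 * (norm (x m))\<^sup>2 - 4 * d n"
      unfolding norm_midpoint_power2 by linarith
    moreover have "1 / real (Suc m) \<le> 1 / real (Suc n)"
      using that by (intro divide_left_mono) auto
    ultimately show ?thesis
      using x(2)[of n] x(2)[of m] d_le_D[of m] unfolding r_def by (simp add: inverse_eq_divide)
  qed
  have "r \<longlonglongrightarrow> 2 * (D - D) + 4 * 0"
    unfolding r_def by (intro tendsto_intros D LIMSEQ_inverse_real_of_nat)
  then have r0: "r \<longlonglongrightarrow> 0" by simp
  have "Cauchy x"
  proof (rule CauchyI')
    fix e :: real assume "e > 0"
    then have "\<forall>\<^sub>F n in sequentially. r n < e\<^sup>2"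
      using order_tendstoD(2)[OF r0, of "e\<^sup>2"] by simp
    then obtain N where N: "\<And>n. n \<ge> N \<Longrightarrow> r n < e\<^sup>2"
      by (auto simp: eventually_sequentially)
    have "dist (x m) (x n) < e" if "m \<ge> N" "n > m" for m n
    proof (unfold dist_norm, rule power2_less_imp_less)
      show "(norm (x m - x n))\<^sup>2 < e\<^sup>2"
        using diff[of m n] N[of m] that by linarith
    qed (use \<open>e > 0\<close> in simp)
    then show "\<exists>M. \<forall>m\<ge>M. \<forall>n>m. dist (x m) (x n) < e" by blast
  qed
  then obtain y where y: "x \<longlonglongrightarrow> y"
    by (auto simp: Cauchy_convergent_iff convergent_def)
  have "y \<in> C n" for n
    by (rule Lim_in_closed_set[OF cl _ _ y])
       (use xC in \<open>auto simp: eventually_sequentially\<close>)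
  then show ?thesis by blast
qed

text \<open>The sublevel sets at heights \<open>r + 1 / real (Suc n)\<close>, with \<open>r\<close>
  the finite infimum, are nested, nonempty, closed, convex and bounded. A common point of them
  attains the infimum.\<close>

lemma ex_is_arg_min_ennreal:
  fixes F :: "'a::{real_inner, complete_space} \<Rightarrow> ennreal"
  assumes fin: "F x0 < \<infinity>"
    and cl: "\<And>a. 0 \<le> a \<Longrightarrow> closed {x. F x \<le> ennreal a}"
    and cv: "\<And>a. 0 \<le> a \<Longrightarrow> convex {x. F x \<le> ennreal a}"
    and bd: "\<And>a. 0 \<le> a \<Longrightarrow> bounded {x. F x \<le> ennreal a}"
  shows "\<exists>x. is_arg_min F (\<lambda>_. True) x"
proof -
  have "Inf (range F) < \<infinity>"
    using fin by (meson INF_lower UNIV_I order_le_less_trans)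
  then obtain r where r: "Inf (range F) = ennreal r" "0 \<le> r"
    by (cases "Inf (range F)") auto
  define C where "C n = {x. F x \<le> ennreal (r + 1 / real (Suc n))}" for n
  have pos: "0 \<le> r + 1 / real (Suc n)" for n
    using r by simp
  have "\<exists>x. \<forall>n. x \<in> C n"
  proof (rule nested_closed_convex_bounded)
    fix n m :: nat assume "n \<le> m"
    then have "1 / real (Suc m) \<le> 1 / real (Suc n)"
      by (intro divide_left_mono) auto
    then show "C m \<subseteq> C n"
      unfolding C_def by (auto simp del: of_nat_Suc elim!: order_trans intro!: ennreal_leI)
  next
    fix n
    have "Inf (range F) < ennreal (r + 1 / real (Suc n))"
      unfolding r(1) using r(2) by (intro ennreal_lessI add_nonneg_pos) (auto simp del: of_nat_Suc)
    then show "C n \<noteq> {}"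
      by (auto simp: C_def Inf_less_iff intro: less_imp_le)
  qed (use pos cl cv bd in \<open>auto simp: C_def simp del: of_nat_Suc\<close>)
  then obtain x where x: "\<And>n. F x \<le> ennreal (r + 1 / real (Suc n))"
    by (auto simp: C_def)
  have "F x \<le> ennreal r"
  proof (rule ennreal_le_epsilon)
    fix e :: real assume "0 < e"
    then obtain n where "1 / real (Suc n) < e"
      using nat_approx_posE by blast
    then have "ennreal (r + 1 / real (Suc n)) \<le> ennreal r + ennreal e"
      using r(2) \<open>0 < e\<close> by (subst ennreal_plus[symmetric]) (auto intro: ennreal_leI)
    then show "F x \<le> ennreal r + ennreal e"
      using x[of n] by (rule order_trans[rotated])
  qed
  then have "F x \<le> F y" for y
    using r(1) by (metis INF_lower UNIV_I order_trans)
  then show ?thesis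
    by (auto simp: is_arg_min_def not_less)
qed

lemma norm_convex_comb_power2:
  fixes x y :: "'a::real_inner"
  shows "(norm ((1 - t) *\<^sub>R x + t *\<^sub>R y))\<^sup>2
    = (1 - t) * (norm x)\<^sup>2 + t * (norm y)\<^sup>2 - t * (1 - t) * (norm (x - y))\<^sup>2"
  by (simp add: power2_norm_eq_inner inner_simps inner_commute algebra_simps)

text \<open>Divide by \<open>t\<close> and let \<open>t\<close> tend to 0 from the right. This turns
  minimality along a segment into a first-order inequality.\<close>

lemma linear_term_nonneg_of_quadratic:
  fixes a b :: real
  assumes "\<And>t. 0 < t \<Longrightarrow> t \<le> 1 \<Longrightarrow> 0 \<le> t * a + t\<^sup>2 * b"
  shows "0 \<le> a"
proof (rule tendsto_lowerbound)
  show "((\<lambda>t. a + t * b) \<longlongrightarrow> a) (at_right 0)"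
    by (rule tendsto_eq_intros refl | simp)+
  have "0 \<le> a + t * b" if "0 < t" "t \<le> 1" for t
    using assms[OF that] that
    by (metis distrib_left mult.assoc power2_eq_square zero_le_mult_iff not_le order_less_le)
  then show "\<forall>\<^sub>F t in at_right 0. 0 \<le> a + t * b"
    by (auto simp: eventually_at_right_field intro!: exI[of _ 1])
qed simp

text \<open>Riesz representation by minimization: the vector representing
  \<open>inner (T x) y\<close> is the minimizer of |z|^2 - 2 \<open>inner (T z) y\<close>.\<close>

lemma ex_adjoint:
  fixes T :: "'a::{real_inner, complete_space} \<Rightarrow> 'b::real_inner"
  assumes T: "bounded_linear T"
  shows "\<exists>T'. \<forall>x y. inner (T x) y = inner x (T' y)"
proof -
  interpret bounded_linear T by fact
  have "\<exists>z. \<forall>x. inner (T x) y = inner x z" for y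
  proof -
    define c where "c = onorm T * norm y"
    \<comment> \<open>The constant \<open>c\<^sup>2\<close> completes the square in
      \<open>r_ge\<close>, so \<open>r\<close> is nonnegative and loses nothing when it is viewed in
      \<open>ennreal\<close>.\<close>
    define r where "r z = (norm z)\<^sup>2 - 2 * inner (T z) y + c\<^sup>2" for z
    have "\<bar>inner (T z) y\<bar> \<le> c * norm z" for z
    proof -
      have "\<bar>inner (T z) y\<bar> \<le> norm (T z) * norm y" by (rule Cauchy_Schwarz_ineq2)
      also have "\<dots> \<le> (onorm T * norm z) * norm y"
        by (intro mult_right_mono onorm[OF T]) auto
      finally show ?thesis by (simp add: c_def mult_ac)
    qed
    then have r_ge: "(norm z - c)\<^sup>2 \<le> r z" for z
      by (simp add: r_def power2_diff) (smt (verit) mult.commute)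
    have r_nonneg: "0 \<le> r z" for z
      using r_ge[of z] zero_le_power2[of "norm z - c"] by linarith
    have r_cv: "r ((1 - t) *\<^sub>R x + t *\<^sub>R z) \<le> (1 - t) * r x + t * r z" if "0 \<le> t" "t \<le> 1" for t x z
    proof -
      have "0 \<le> t * (1 - t) * (norm (x - z))\<^sup>2" using that by simp
      moreover have "T ((1 - t) *\<^sub>R x + t *\<^sub>R z) = (1 - t) *\<^sub>R T x + t *\<^sub>R T z"
        by (simp only: add scaleR)
      ultimately show ?thesis
        unfolding r_def norm_convex_comb_power2
        by (simp only: inner_add_left inner_scaleR_left) (simp add: algebra_simps)
    qed
    have "\<exists>z. is_arg_min (\<lambda>z. ennreal (r z)) (\<lambda>_. True) z"
    proof (rule ex_is_arg_min_ennreal)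
      fix a :: real assume "0 \<le> a"
      then have eq: "{x. ennreal (r x) \<le> ennreal a} = {x. r x \<le> a}"
        by (simp add: ennreal_le_iff)
      show "closed {x. ennreal (r x) \<le> ennreal a}"
        unfolding eq unfolding r_def by (intro closed_Collect_le continuous_intros continuous_on)
      show "convex {x. ennreal (r x) \<le> ennreal a}"
        unfolding eq convex_alt
      proof clarsimp
        fix x z t assume *: "r x \<le> a" "r z \<le> a" "0 \<le> t" "t \<le> (1::real)"
        then show "r ((1 - t) *\<^sub>R x + t *\<^sub>R z) \<le> a"
          using r_cv[of t x z] convex_bound_le[of "r x" a "r z" "1 - t" t] by simp
      qed
      show "bounded {x. ennreal (r x) \<le> ennreal a}"
        unfolding eq bounded_iff
      proof (intro exI ballI)
        fix x assume "x \<in> {x. r x \<le> a}"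
        with r_ge[of x] have "(norm x - c)\<^sup>2 \<le> a" by simp
        then have "\<bar>norm x - c\<bar> \<le> sqrt a"
          using real_le_rsqrt by fastforce
        then show "norm x \<le> c + sqrt a" by linarith
      qed
    qed simp
    then obtain z where z: "\<And>w. r z \<le> r w"
      using r_nonneg by (auto simp: is_arg_min_def not_less)
    \<comment> \<open>Perturbing the minimizer in direction \<open>x\<close> gives one inequality;
      direction \<open>- x\<close> gives the other.\<close>
    have le: "inner (T x) y \<le> inner x z" for x
    proof -
      have "0 \<le> t * (2 * inner x z - 2 * inner (T x) y) + t\<^sup>2 * (norm x)\<^sup>2" for t
        using z[of "z + t *\<^sub>R x"]
        by (simp add: r_def power2_norm_eq_inner inner_simps add scaleR)
           (simp add: inner_commute algebra_simps power2_eq_square)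
      from linear_term_nonneg_of_quadratic[OF this] show ?thesis by simp
    qed
    have "inner (T x) y = inner x z" for x
      using le[of x] le[of "- x"] by (simp add: neg)
    then show ?thesis by blast
  qed
  then show ?thesis by metis
qed

text \<open>\<open>adjoint\<close> is defined by choice, so its characteristic identity becomes
  available only through existence, supplied by \<open>ex_adjoint\<close>.\<close>

lemma inner_adjoint:
  fixes T :: "'a::{real_inner, complete_space} \<Rightarrow> 'b::real_inner"
  assumes "bounded_linear T"
  shows "inner x (adjoint T y) = inner (T x) y"
proof -
  obtain T' where T': "\<forall>x y. inner (T x) y = inner x (T' y)"
    using ex_adjoint[OF assms] by blast
  then show ?thesis
    by (simp add: adjoint_unique[OF T'])
qed

lemma norm_adjoint_le:
  fixes T :: "'a::{real_inner, complete_space} \<Rightarrow> 'b::real_inner"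
  assumes "bounded_linear T"
  shows "norm (adjoint T y) \<le> onorm T * norm y"
proof -
  have "(norm (adjoint T y))\<^sup>2 = inner (T (adjoint T y)) y"
    using inner_adjoint[OF assms] by (simp add: power2_norm_eq_inner)
  also have "\<dots> \<le> norm (T (adjoint T y)) * norm y"
    by (rule norm_cauchy_schwarz)
  also have "\<dots> \<le> (onorm T * norm (adjoint T y)) * norm y"
    by (intro mult_right_mono onorm assms) auto
  finally have "norm (adjoint T y) * norm (adjoint T y) \<le> norm (adjoint T y) * (onorm T * norm y)"
    by (simp add: power2_eq_square mult_ac)
  then show ?thesis
    using onorm_pos_le[OF assms] by (cases "adjoint T y = 0") auto
qed

section \<open>Quadratic functionals with a convex penalty\<close>

lemma convex_norm_power2_le:
  fixes x y :: "'a::real_inner"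
  assumes "0 \<le> t" "t \<le> 1"
  shows "(norm ((1 - t) *\<^sub>R x + t *\<^sub>R y))\<^sup>2 \<le> (1 - t) * (norm x)\<^sup>2 + t * (norm y)\<^sup>2"
  unfolding norm_convex_comb_power2 using assms by simp

lemma tendsto_0_if_norm_power2:
  fixes f :: "'b \<Rightarrow> 'a::real_normed_vector"
  assumes "((\<lambda>x. (norm (f x))\<^sup>2) \<longlongrightarrow> 0) F"
  shows "(f \<longlongrightarrow> 0) F"
  using tendsto_real_sqrt[OF assms] by (simp add: tendsto_norm_zero_iff)

text \<open>
  Convexity and lower semicontinuity are expressed through real bounds, which avoids arithmetic
  with the value \<open>\<infinity>\<close>.
\<close>

locale convex_penalty =
  fixes P :: "'a::{real_inner, complete_space} \<Rightarrow> ennreal"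
  assumes zero: "P 0 = 0"
    and cvx: "\<And>x y a b t. \<lbrakk>P x \<le> ennreal a; P y \<le> ennreal b; 0 \<le> a; 0 \<le> b; 0 \<le> t; t \<le> 1\<rbrakk>
      \<Longrightarrow> P ((1 - t) *\<^sub>R x + t *\<^sub>R y) \<le> ennreal ((1 - t) * a + t * b)"
    and closed_sublevel: "\<And>a. 0 \<le> a \<Longrightarrow> closed {x. P x \<le> ennreal a}"
begin

definition D where "D = {x. P x < \<infinity>}"
text \<open>Where \<open>P\<close> is infinite, \<open>enn2real\<close> returns 0, so
  \<open>psi\<close> represents \<open>P\<close> only on the effective domain
  \<open>D\<close>.\<close>

definition psi where "psi x = enn2real (P x)"

text \<open>Covers both problems at once: \<open>S = T\<close>, \<open>b = g\<close> gives the
  functional \<open>K\<close>, and the identity with \<open>b = a\<close> gives the functional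
  behind \<open>U\<close> at \<open>a\<close>.\<close>

definition objective :: "('a \<Rightarrow> 'c::real_inner) \<Rightarrow> 'c \<Rightarrow> 'a \<Rightarrow> ennreal"
  where "objective S b z = ennreal ((norm (S z - b))\<^sup>2) + P z"

definition is_min :: "('a \<Rightarrow> 'c::real_inner) \<Rightarrow> 'c \<Rightarrow> 'a \<Rightarrow> bool"
  where "is_min S b = is_arg_min (objective S b) (\<lambda>_. True)"

lemma psi_nonneg [simp]: "0 \<le> psi x"
  by (simp add: psi_def)

lemma P_eq: "x \<in> D \<Longrightarrow> P x = ennreal (psi x)"
  by (simp add: D_def psi_def)

lemma P_le_iff: "0 \<le> a \<Longrightarrow> P x \<le> ennreal a \<longleftrightarrow> x \<in> D \<and> psi x \<le> a"
proof (cases "x \<in> D")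
  case False
  then show ?thesis
    using order_le_less_trans[of "P x" "ennreal a" top] by (auto simp: D_def)
qed (simp add: P_eq ennreal_le_iff)

lemma zero_in_D: "0 \<in> D"
  by (simp add: D_def zero)

lemma D_convex_comb:
  assumes "x \<in> D" "y \<in> D" "0 \<le> t" "t \<le> 1"
  shows "(1 - t) *\<^sub>R x + t *\<^sub>R y \<in> D"
    and "psi ((1 - t) *\<^sub>R x + t *\<^sub>R y) \<le> (1 - t) * psi x + t * psi y"
  using cvx[of x "psi x" y "psi y" t] assms P_le_iff[of "(1 - t) * psi x + t * psi y"]
  by (auto simp: P_eq)

lemma objective_eq:
  "z \<in> D \<Longrightarrow> objective S b z = ennreal ((norm (S z - b))\<^sup>2 + psi z)"
  by (simp add: objective_def P_eq)

lemma objective_top: "z \<notin> D \<Longrightarrow> objective S b z = \<infinity>"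
  by (simp add: objective_def D_def not_less top_unique)

lemma objective_le_iff:
  "0 \<le> a \<Longrightarrow> objective S b z \<le> ennreal a \<longleftrightarrow> z \<in> D \<and> (norm (S z - b))\<^sup>2 + psi z \<le> a"
  by (cases "z \<in> D") (auto simp: objective_eq objective_top top_unique ennreal_le_iff simp del: ennreal_plus)

text \<open>The objective is finite at 0, so a minimizer lies in \<open>D\<close>, and only real
  values remain to be compared.\<close>

lemma is_min_iff:
  "is_min S b z \<longleftrightarrow> z \<in> D \<and> (\<forall>w\<in>D. (norm (S z - b))\<^sup>2 + psi z \<le> (norm (S w - b))\<^sup>2 + psi w)"
proof -
  have "is_min S b z \<longleftrightarrow> (\<forall>w. objective S b z \<le> objective S b w)"
    by (auto simp: is_min_def is_arg_min_def not_less)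
  also have "\<dots> \<longleftrightarrow> z \<in> D \<and> (\<forall>w\<in>D. objective S b z \<le> objective S b w)"
  proof (intro iffI conjI)
    assume *: "\<forall>w. objective S b z \<le> objective S b w"
    show "z \<in> D"
    proof (rule ccontr)
      assume "z \<notin> D"
      then show False
        using *[rule_format, of 0] zero_in_D by (simp add: objective_eq objective_top top_unique)
    qed
  next
    assume *: "z \<in> D \<and> (\<forall>w\<in>D. objective S b z \<le> objective S b w)"
    show "\<forall>w. objective S b z \<le> objective S b w"
    proof
      fix w show "objective S b z \<le> objective S b w"
        using * by (cases "w \<in> D") (auto simp: objective_top)
    qed
  qed auto
  also have "\<dots> \<longleftrightarrow> z \<in> D \<and> (\<forall>w\<in>D. (norm (S z - b))\<^sup>2 + psi z \<le> (norm (S w - b))\<^sup>2 + psi w)"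
    by (auto simp: objective_eq ennreal_le_iff simp del: ennreal_plus)
  finally show ?thesis .
qed

text \<open>First-order optimality without subgradients. Necessity: move from \<open>z\<close>
  towards \<open>w\<close>, bound \<open>psi\<close> by convexity and keep the term linear in
  \<open>t\<close>. Sufficiency: expand the square at \<open>t = 1\<close> and drop its nonnegative
  quadratic term.\<close>

lemma is_min_variational_iff:
  assumes "linear S"
  shows "is_min S b z \<longleftrightarrow> z \<in> D \<and> (\<forall>w\<in>D. psi z + 2 * inner (b - S z) (S w - S z) \<le> psi w)"
proof -
  interpret linear S by fact
  have expand: "(norm (S z + t *\<^sub>R (S w - S z) - b))\<^sup>2
      = (norm (S z - b))\<^sup>2 - t * (2 * inner (b - S z) (S w - S z)) + t\<^sup>2 * (norm (S w - S z))\<^sup>2" for t w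
    by (simp only: power2_norm_eq_inner inner_simps) (simp add: inner_commute algebra_simps power2_eq_square)
  have "psi z + 2 * inner (b - S z) (S w - S z) \<le> psi w" if "is_min S b z" "w \<in> D" for w
  proof -
    have z: "z \<in> D" and min: "\<And>w. w \<in> D \<Longrightarrow> (norm (S z - b))\<^sup>2 + psi z \<le> (norm (S w - b))\<^sup>2 + psi w"
      using that(1) by (auto simp: is_min_iff)
    have "0 \<le> psi w - psi z - 2 * inner (b - S z) (S w - S z)"
    proof (rule linear_term_nonneg_of_quadratic)
      fix t :: real assume t: "0 < t" "t \<le> 1"
      have eq: "S ((1 - t) *\<^sub>R z + t *\<^sub>R w) = S z + t *\<^sub>R (S w - S z)"
        by (simp only: add scale) (simp add: algebra_simps)
      \<comment> \<open>\<open>n\<close> is the squared misfit at \<open>z\<close>, \<open>a\<close>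
        and \<open>c\<close> are \<open>psi\<close> at \<open>z\<close> and \<open>w\<close>,
        \<open>m\<close> is \<open>psi\<close> at the point on the segment, and \<open>i\<close> and
        \<open>q\<close> come from \<open>expand\<close>.\<close>
      have arith: "0 \<le> t * (c - a - i) + q"
        if "n + a \<le> n - t * i + q + m" "m \<le> (1 - t) * a + t * c" for a c i q n m :: real
        using that by (simp add: algebra_simps)
      show "0 \<le> t * (psi w - psi z - 2 * inner (b - S z) (S w - S z)) + t\<^sup>2 * (norm (S w - S z))\<^sup>2"
        using min[OF D_convex_comb(1)[OF z that(2) less_imp_le[OF t(1)] t(2)]]
          D_convex_comb(2)[OF z that(2) less_imp_le[OF t(1)] t(2)]
        unfolding eq expand by (rule arith)
    qed
    then show ?thesis by simp
  qed
  moreover have "is_min S b z"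
    if "z \<in> D" "\<And>w. w \<in> D \<Longrightarrow> psi z + 2 * inner (b - S z) (S w - S z) \<le> psi w"
    unfolding is_min_iff
  proof (intro conjI ballI)
    fix w assume "w \<in> D"
    have eq: "S z + 1 *\<^sub>R (S w - S z) - b = S w - b"
      by simp
    from that(2)[OF \<open>w \<in> D\<close>] expand[of 1 w, unfolded eq mult_1 power_one]
      zero_le_power2[of "norm (S w - S z)"]
    show "(norm (S z - b))\<^sup>2 + psi z \<le> (norm (S w - b))\<^sup>2 + psi w"
      by linarith
  qed fact
  ultimately show ?thesis
    by (auto simp: is_min_iff)
qed

text \<open>Along a convergent sequence in the set, \<open>psi\<close> is at most \<open>a\<close>
  minus the misfit, which converges to \<open>r\<close>. The sequence eventually lies in the closed
  sublevel set of \<open>P\<close> at height \<open>r + e\<close>, hence so does its limit, for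
  every \<open>e > 0\<close>.\<close>

lemma closed_sublevel_objective:
  assumes S: "continuous_on UNIV S" and "0 \<le> a"
  shows "closed {x. objective S b x \<le> ennreal a}"
  unfolding closed_sequential_limits
proof (intro allI impI, elim conjE)
  fix x l assume x: "\<forall>n. x n \<in> {x. objective S b x \<le> ennreal a}" and l: "x \<longlonglongrightarrow> l"
  have xD: "x n \<in> D" and xa: "(norm (S (x n) - b))\<^sup>2 + psi (x n) \<le> a" for n
    using x \<open>0 \<le> a\<close> by (auto simp: objective_le_iff)
  define r where "r = a - (norm (S l - b))\<^sup>2"
  have lim: "(\<lambda>n. a - (norm (S (x n) - b))\<^sup>2) \<longlonglongrightarrow> r"
    unfolding r_def by (intro tendsto_intros continuous_on_tendsto_compose[OF S l]) auto
  have "0 \<le> a - (norm (S (x n) - b))\<^sup>2" for n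
    using xa[of n] psi_nonneg[of "x n"] by linarith
  then have r0: "0 \<le> r"
    by (intro LIMSEQ_le_const[OF lim]) blast
  have le: "l \<in> D \<and> psi l \<le> r + e" if "e > 0" for e
  proof -
    have "\<forall>\<^sub>F n in sequentially. a - (norm (S (x n) - b))\<^sup>2 < r + e"
      using order_tendstoD(2)[OF lim, of "r + e"] that by simp
    then have "\<forall>\<^sub>F n in sequentially. x n \<in> {x. P x \<le> ennreal (r + e)}"
    proof eventually_elim
      case (elim n)
      then show ?case
        using xD[of n] xa[of n] r0 that by (simp add: P_le_iff del: ennreal_plus)
    qed
    then have "l \<in> {x. P x \<le> ennreal (r + e)}"
      using r0 that by (intro Lim_in_closed_set[OF closed_sublevel _ _ l]) auto
    then show ?thesis
      using r0 that by (simp add: P_le_iff del: ennreal_plus)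
  qed
  have "psi l \<le> r"
    by (rule field_le_epsilon) (use le in blast)
  then show "l \<in> {x. objective S b x \<le> ennreal a}"
    using le[of 1] \<open>0 \<le> a\<close> by (simp add: objective_le_iff r_def)
qed

lemma convex_sublevel_objective:
  assumes "linear S" and "0 \<le> a"
  shows "convex {x. objective S b x \<le> ennreal a}"
  unfolding convex_alt
proof clarify
  fix x y and t :: real
  assume *: "objective S b x \<le> ennreal a" "objective S b y \<le> ennreal a" and t: "0 \<le> t" "t \<le> 1"
  interpret linear S by fact
  have x: "x \<in> D" "(norm (S x - b))\<^sup>2 + psi x \<le> a" and y: "y \<in> D" "(norm (S y - b))\<^sup>2 + psi y \<le> a"
    using * \<open>0 \<le> a\<close> by (auto simp: objective_le_iff)
  have eq: "S ((1 - t) *\<^sub>R x + t *\<^sub>R y) - b = (1 - t) *\<^sub>R (S x - b) + t *\<^sub>R (S y - b)"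
    by (simp only: add scale) (simp add: algebra_simps)
  have "(norm (S ((1 - t) *\<^sub>R x + t *\<^sub>R y) - b))\<^sup>2 + psi ((1 - t) *\<^sub>R x + t *\<^sub>R y)
      \<le> (1 - t) * ((norm (S x - b))\<^sup>2 + psi x) + t * ((norm (S y - b))\<^sup>2 + psi y)"
    using convex_norm_power2_le[OF t, of "S x - b" "S y - b"] D_convex_comb(2)[OF x(1) y(1) t]
    unfolding eq by (simp add: algebra_simps)
  also have "\<dots> \<le> a"
    using convex_bound_le[OF x(2) y(2), of "1 - t" t] t by simp
  finally show "objective S b ((1 - t) *\<^sub>R x + t *\<^sub>R y) \<le> ennreal a"
    using D_convex_comb(1)[OF x(1) y(1) t] \<open>0 \<le> a\<close> by (simp add: objective_le_iff)
qed

lemma ex_is_min: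
  assumes S: "bounded_linear S"
    and bd: "\<And>a. 0 \<le> a \<Longrightarrow> bounded {x. objective S b x \<le> ennreal a}"
  shows "\<exists>z. is_min S b z"
proof -
  have "objective S b 0 < \<infinity>"
    by (simp add: objective_def zero)
  then have "\<exists>z. is_arg_min (objective S b) (\<lambda>_. True) z"
    by (rule ex_is_arg_min_ennreal)
       (fact closed_sublevel_objective[OF linear_continuous_on[OF S]]
         convex_sublevel_objective[OF bounded_linear.linear[OF S]] bd)+
  then show ?thesis
    by (simp add: is_min_def)
qed

lemma ex_is_min_id: "\<exists>z. is_min (\<lambda>x. x) b z"
proof (rule ex_is_min)
  fix a :: real assume a: "0 \<le> a"
  show "bounded {x. objective (\<lambda>x. x) b x \<le> ennreal a}"
    unfolding bounded_iff
  proof (intro exI ballI)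
    fix x assume "x \<in> {x. objective (\<lambda>x. x) b x \<le> ennreal a}"
    then have "(norm (x - b))\<^sup>2 + psi x \<le> a"
      using a by (simp add: objective_le_iff)
    then have "(norm (x - b))\<^sup>2 \<le> a"
      using psi_nonneg[of x] by linarith
    then have "norm (x - b) \<le> sqrt a"
      by (rule real_le_rsqrt)
    then show "norm x \<le> norm b + sqrt a"
      using norm_triangle_sub[of x b] by linarith
  qed
qed (rule bounded_linear_ident)

lemma is_min_id_variational:
  assumes "is_min (\<lambda>x. x) a z"
  shows "z \<in> D" and "\<And>w. w \<in> D \<Longrightarrow> psi z + 2 * inner (a - z) (w - z) \<le> psi w"
  using assms by (auto simp: is_min_variational_iff linear_id[unfolded id_def])

text \<open>Test each variational inequality at the other minimizer and add: the \<open>psi\<close>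
  terms cancel.\<close>

lemma is_min_id_firmly_nonexpansive:
  assumes "is_min (\<lambda>x. x) a z" "is_min (\<lambda>x. x) a' z'"
  shows "(norm (z - z'))\<^sup>2 \<le> inner (a - a') (z - z')"
proof -
  have "inner (a - z) (z' - z) + inner (a' - z') (z - z') = (norm (z - z'))\<^sup>2 - inner (a - a') (z - z')"
    by (simp only: power2_norm_eq_inner inner_simps)
  then show ?thesis
    using is_min_id_variational(2)[OF assms(1) is_min_id_variational(1)[OF assms(2)]]
      is_min_id_variational(2)[OF assms(2) is_min_id_variational(1)[OF assms(1)]]
    by linarith
qed

end

section \<open>The forward-backward iteration\<close>

text \<open>A gradient step of size 1/2 for the squared misfit |T x - g|^2.\<close>

definition landweber :: "('a::real_inner \<Rightarrow> 'h::real_inner) \<Rightarrow> 'h \<Rightarrow> 'a \<Rightarrow> 'a"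
  where "landweber T g x = x + adjoint T (g - T x)"

lemma landweber_diff:
  fixes T :: "'a::{real_inner, complete_space} \<Rightarrow> 'h::real_inner"
  assumes "bounded_linear T"
  shows "landweber T g x - landweber T g y = (x - y) - adjoint T (T (x - y))"
proof -
  have "adjoint T (a - b) = adjoint T a - adjoint T b" for a b
    by (rule vector_eq_ldot[THEN iffD1]) (simp add: inner_adjoint[OF assms] inner_diff_right)
  from this[of "g - T x" "g - T y"] this[of "T y" "T x"] this[of "T x" "T y"] show ?thesis
    by (simp add: landweber_def bounded_linear.linear[OF assms] linear_diff)
qed

text \<open>In the expanded square the cross term is -2 |T (x - y)|^2 and the last term is at most
  |T (x - y)|^2. The surplus is kept because it later forces \<open>T (u m - z)\<close> to
  0.\<close>

lemma norm_landweber_diff: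
  fixes T :: "'a::{real_inner, complete_space} \<Rightarrow> 'h::real_inner"
  assumes T: "bounded_linear T" and "onorm T \<le> 1"
  shows "(norm (landweber T g x - landweber T g y))\<^sup>2 \<le> (norm (x - y))\<^sup>2 - (norm (T (x - y)))\<^sup>2"
proof -
  have "norm (adjoint T (T (x - y))) \<le> norm (T (x - y))"
    using norm_adjoint_le[OF T, of "T (x - y)"] mult_right_mono[OF \<open>onorm T \<le> 1\<close>, of "norm (T (x - y))"]
    by simp
  then have "(norm (adjoint T (T (x - y))))\<^sup>2 \<le> (norm (T (x - y)))\<^sup>2"
    by (simp add: power_mono)
  moreover have "(norm (x - y - adjoint T (T (x - y))))\<^sup>2
      = (norm (x - y))\<^sup>2 - 2 * inner (x - y) (adjoint T (T (x - y))) + (norm (adjoint T (T (x - y))))\<^sup>2"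
    by (simp only: power2_norm_eq_inner inner_diff_left inner_diff_right) (simp add: inner_commute)
  ultimately show ?thesis
    unfolding landweber_diff[OF T] inner_adjoint[OF T] by (simp add: power2_norm_eq_inner)
qed

locale forward_backward = convex_penalty P
  for P :: "'a::{real_inner, complete_space} \<Rightarrow> ennreal" +
  fixes T :: "'a \<Rightarrow> 'h::real_inner" and g :: 'h and u :: "nat \<Rightarrow> 'a"
  assumes T: "bounded_linear T" and onorm_T: "onorm T \<le> 1"
    and iter: "\<And>m. is_min (\<lambda>x. x) (landweber T g (u m)) (u (Suc m))"
begin

text \<open>Moving \<open>T\<close> across the inner product makes the variational inequalities of
  the two problems literally the same.\<close>

lemma is_min_iff_fixed_point: "is_min T g z \<longleftrightarrow> is_min (\<lambda>x. x) (landweber T g z) z"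
proof -
  have "inner (landweber T g z - z) (w - z) = inner (g - T z) (T w - T z)" for w
    using inner_adjoint[OF T, of "w - z" "g - T z"]
    by (simp add: landweber_def inner_commute bounded_linear.linear[OF T] linear_diff)
  then show ?thesis
    by (simp add: is_min_variational_iff bounded_linear.linear[OF T] linear_id[unfolded id_def])
qed

text \<open>With \<open>h\<close> and \<open>d\<close> the differences before and after
  minimization, firm nonexpansiveness gives |h - d|^2 <= |h|^2 - |d|^2, and
  \<open>norm_landweber_diff\<close> bounds |h|^2.\<close>

lemma step:
  assumes "is_min (\<lambda>x. x) (landweber T g x) x'" "is_min (\<lambda>x. x) (landweber T g y) y'"
  shows "(norm (landweber T g x - landweber T g y - (x' - y')))\<^sup>2 + (norm (T (x - y)))\<^sup>2
    \<le> (norm (x - y))\<^sup>2 - (norm (x' - y'))\<^sup>2"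
proof -
  have "(norm (h - d))\<^sup>2 = (norm h)\<^sup>2 - 2 * inner h d + (norm d)\<^sup>2" for h d :: 'a
    by (simp only: power2_norm_eq_inner inner_diff_left inner_diff_right) (simp add: inner_commute)
  from this[of "landweber T g x - landweber T g y" "x' - y'"] show ?thesis
    using is_min_id_firmly_nonexpansive[OF assms] norm_landweber_diff[OF T onorm_T, of g x y]
    by linarith
qed

section \<open>Monotonicity with respect to a fixed minimizer\<close>

context
  fixes z assumes z: "is_min T g z"
begin

lemma step_to_min:
  "(norm (landweber T g (u m) - landweber T g z - (u (Suc m) - z)))\<^sup>2 + (norm (T (u m - z)))\<^sup>2
    \<le> (norm (u m - z))\<^sup>2 - (norm (u (Suc m) - z))\<^sup>2"
  using step[OF iter] z is_min_iff_fixed_point by blast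

lemma decseq_norm_diff: "decseq (\<lambda>m. norm (u m - z))"
proof (rule decseq_SucI, rule power2_le_imp_le)
  fix m show "(norm (u (Suc m) - z))\<^sup>2 \<le> (norm (u m - z))\<^sup>2"
    using step_to_min[of m]
      zero_le_power2[of "norm (landweber T g (u m) - landweber T g z - (u (Suc m) - z))"]
      zero_le_power2[of "norm (T (u m - z))"] by linarith
qed simp

text \<open>The right-hand side of \<open>step_to_min\<close> is a difference of consecutive terms
  of a convergent sequence, so both squares on the left are squeezed to 0.\<close>

lemma residuals_tendsto_0:
  "(\<lambda>m. landweber T g (u m) - landweber T g z - (u (Suc m) - z)) \<longlonglongrightarrow> 0" (is "?h \<longlonglongrightarrow> 0")
  "(\<lambda>m. T (u m - z)) \<longlonglongrightarrow> 0"
proof -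
  obtain L where L: "(\<lambda>m. norm (u m - z)) \<longlonglongrightarrow> L"
    using decseq_convergent[OF decseq_norm_diff, of 0] by auto
  have *: "(\<lambda>m. (norm (u m - z))\<^sup>2 - (norm (u (Suc m) - z))\<^sup>2) \<longlonglongrightarrow> 0"
    using tendsto_diff[OF tendsto_power[OF L, of 2] tendsto_power[OF LIMSEQ_Suc[OF L], of 2]] by simp
  have "(\<lambda>m. (norm (?h m))\<^sup>2) \<longlonglongrightarrow> 0"
    by (rule tendsto_sandwich[OF _ _ tendsto_const *])
       (auto intro!: always_eventually order_trans[OF _ step_to_min])
  then show "?h \<longlonglongrightarrow> 0"
    by (rule tendsto_0_if_norm_power2)
  have "(\<lambda>m. (norm (T (u m - z)))\<^sup>2) \<longlonglongrightarrow> 0"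
    by (rule tendsto_sandwich[OF _ _ tendsto_const *])
       (auto intro!: always_eventually order_trans[OF _ step_to_min])
  then show "(\<lambda>m. T (u m - z)) \<longlonglongrightarrow> 0"
    by (rule tendsto_0_if_norm_power2)
qed

text \<open>The increment is minus the sum of the first residual and
  \<open>adjoint T (T (u m - z))\<close>, and both tend to 0.\<close>

lemma asymptotically_regular: "(\<lambda>m. u (Suc m) - u m) \<longlonglongrightarrow> 0"
proof -
  have "(\<lambda>m. adjoint T (T (u m - z))) \<longlonglongrightarrow> 0"
  proof (rule tendsto_norm_zero_cancel, rule tendsto_sandwich[OF _ _ tendsto_const])
    show "(\<lambda>m. onorm T * norm (T (u m - z))) \<longlonglongrightarrow> 0"
      by (intro tendsto_mult_right_zero tendsto_norm_zero residuals_tendsto_0(2))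
  qed (auto intro!: always_eventually norm_adjoint_le[OF T])
  from tendsto_minus[OF tendsto_add[OF residuals_tendsto_0(1) this]] show ?thesis
    by (simp add: landweber_diff[OF T] algebra_simps)
qed

text \<open>Let \<open>y\<close> be the image of \<open>w\<close> under one iteration. The shifted
  subsequence tends to \<open>y\<close> by nonexpansiveness and to \<open>w\<close> by asymptotic
  regularity, so \<open>w\<close> is a fixed point. The distance to \<open>w\<close> then decreases
  along the whole sequence and vanishes along a subsequence.\<close>

lemma convergent_if_subseq:
  assumes r: "strict_mono r" and w: "(u \<circ> r) \<longlonglongrightarrow> w"
  shows "is_min T g w \<and> u \<longlonglongrightarrow> w"
proof -
  obtain y where y: "is_min (\<lambda>x. x) (landweber T g w) y"
    using ex_is_min_id by blast
  have w0: "(\<lambda>k. norm (u (r k) - w)) \<longlonglongrightarrow> 0"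
    using w by (simp add: o_def LIM_zero tendsto_norm_zero)
  have le: "norm (u (Suc m) - y) \<le> norm (u m - w)" for m
  proof (rule power2_le_imp_le)
    show "(norm (u (Suc m) - y))\<^sup>2 \<le> (norm (u m - w))\<^sup>2"
      using step[OF iter y, of m]
        zero_le_power2[of "norm (landweber T g (u m) - landweber T g w - (u (Suc m) - y))"]
        zero_le_power2[of "norm (T (u m - w))"] by linarith
  qed simp
  have "(\<lambda>k. norm (u (Suc (r k)) - y)) \<longlonglongrightarrow> 0"
    by (rule tendsto_sandwich[OF _ _ tendsto_const w0]) (auto intro!: always_eventually le)
  then have "(\<lambda>k. u (Suc (r k))) \<longlonglongrightarrow> y"
    by (rule LIM_zero_cancel[OF tendsto_norm_zero_cancel])
  moreover have "(\<lambda>k. u (Suc (r k))) \<longlonglongrightarrow> w"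
    using tendsto_add[OF LIMSEQ_subseq_LIMSEQ[OF asymptotically_regular r] w] by (simp add: o_def)
  ultimately have "y = w"
    by (rule LIMSEQ_unique)
  with y le have min: "is_min T g w" and dec: "decseq (\<lambda>m. norm (u m - w))"
    by (auto simp: is_min_iff_fixed_point intro!: decseq_SucI)
  obtain L where L: "(\<lambda>m. norm (u m - w)) \<longlonglongrightarrow> L"
    using decseq_convergent[OF dec, of 0] by auto
  have "L = 0"
    using LIMSEQ_unique[OF LIMSEQ_subseq_LIMSEQ[OF L r]] w0 by (simp add: o_def)
  with L have "u \<longlonglongrightarrow> w"
    by simp (rule LIM_zero_cancel[OF tendsto_norm_zero_cancel])
  with min show ?thesis by blast
qed

end

end

section \<open>The \<open>\<ell>\<^sub>q\<close>-norms and square-summable families\<close>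

text \<open>Includes the endpoint 0, where convexity reduces to \<open>s powr p \<le> s\<close> for
  \<open>s\<close> in (0,1).\<close>

lemma powr_convex_nonneg:
  fixes p :: real
  assumes "1 \<le> p"
  shows "convex_on {0..} (\<lambda>x. x powr p)"
proof (rule convex_onI)
  fix t x y :: real
  assume t: "0 < t" "t < 1" and xy: "x \<in> {0..}" "y \<in> {0..}"
  have shrink: "(s * z) powr p \<le> s * z powr p" if "0 < s" "s < 1" "0 \<le> z" for s z :: real
  proof -
    have "s powr p \<le> s powr 1"
      using that assms by (intro powr_mono') auto
    then have "s powr p \<le> s"
      using that by simp
    then show ?thesis
      using that by (simp add: powr_mult mult_right_mono)
  qed
  consider "x = 0" | "y = 0" | "0 < x" "0 < y"
    using xy by force
  then show "((1 - t) *\<^sub>R x + t *\<^sub>R y) powr p \<le> (1 - t) * x powr p + t * y powr p"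
  proof cases
    case 3
    then show ?thesis
      using convex_onD[OF powr_convex[OF assms], of t x y] t by simp
  qed (use shrink[of t y] shrink[of "1 - t" x] t xy in auto)
qed simp

context
  fixes q :: ennreal
  assumes q: "1 \<le> q"
begin

lemma enn2real_exponent_ge_1: "q \<noteq> \<infinity> \<Longrightarrow> 1 \<le> enn2real q"
  using q by (cases q) (auto simp: ennreal_le_iff simp flip: ennreal_1)

lemma lq_norm_zero: "lq_norm q 0 = 0"
  by (simp add: lq_norm_def)

lemma abs_nth_le_lq_norm: "\<bar>x $ i\<bar> \<le> lq_norm q x"
proof (cases "q = \<infinity>")
  case False
  define p where "p = enn2real q"
  have p: "1 \<le> p"
    unfolding p_def by (rule enn2real_exponent_ge_1[OF False])
  have "\<bar>x $ i\<bar> = (\<bar>x $ i\<bar> powr p) powr (1 / p)"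
    using p by (simp add: powr_powr)
  also have "\<dots> \<le> (\<Sum>i\<in>UNIV. \<bar>x $ i\<bar> powr p) powr (1 / p)"
    using p by (intro powr_mono2 member_le_sum) auto
  finally show ?thesis
    using False by (simp add: lq_norm_def p_def)
qed (simp add: lq_norm_def)

lemma lq_norm_nonneg: "0 \<le> lq_norm q x"
  by (rule order_trans[OF abs_ge_zero abs_nth_le_lq_norm])

text \<open>Passing through the sum of the absolute coordinates gives a constant independent of
  \<open>q\<close>; its size is immaterial later.\<close>

lemma norm_le_card_lq_norm:
  fixes x :: "real ^ 'm"
  shows "norm x \<le> real CARD('m) * lq_norm q x"
proof -
  have "norm x \<le> (\<Sum>i\<in>UNIV. \<bar>x $ i\<bar>)"
    by (rule norm_le_l1_cart)
  also have "\<dots> \<le> (\<Sum>i\<in>(UNIV :: 'm set). lq_norm q x)"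
    by (intro sum_mono abs_nth_le_lq_norm)
  finally show ?thesis by simp
qed

text \<open>For finite \<open>q\<close> this is Minkowski's inequality by normalization: rescale
  \<open>x\<close> and \<open>y\<close> by positive bounds \<open>a\<close> and \<open>b\<close> of
  their norms, apply convexity of \<open>powr\<close> coordinatewise and sum.\<close>

lemma convex_lq_norm: "convex_on UNIV (lq_norm q :: real ^ 'm \<Rightarrow> real)"
proof (rule convex_onI)
  fix t :: real and x y :: "real ^ 'm"
  assume t: "0 < t" "t < 1"
  show "lq_norm q ((1 - t) *\<^sub>R x + t *\<^sub>R y) \<le> (1 - t) * lq_norm q x + t * lq_norm q y"
  proof (cases "q = \<infinity>")
    case True
    have "\<bar>((1 - t) *\<^sub>R x + t *\<^sub>R y) $ i\<bar> \<le> (1 - t) * lq_norm q x + t * lq_norm q y" for i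
    proof -
      have "\<bar>((1 - t) *\<^sub>R x + t *\<^sub>R y) $ i\<bar> \<le> (1 - t) * \<bar>x $ i\<bar> + t * \<bar>y $ i\<bar>"
        using t abs_triangle_ineq[of "(1 - t) * x $ i" "t * y $ i"] by (simp add: abs_mult)
      also have "\<dots> \<le> (1 - t) * lq_norm q x + t * lq_norm q y"
        using t by (intro add_mono mult_left_mono abs_nth_le_lq_norm) auto
      finally show ?thesis .
    qed
    then show ?thesis
      using True by (simp add: lq_norm_def)
  next
    case False
    define p where "p = enn2real q"
    have p: "1 \<le> p"
      unfolding p_def by (rule enn2real_exponent_ge_1[OF False])
    define s where "s x = (\<Sum>i\<in>UNIV. \<bar>x $ i\<bar> powr p)" for x :: "real ^ 'm"
    have lq: "lq_norm q x = s x powr (1 / p)" for x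
      using False by (simp add: lq_norm_def s_def p_def)
    have s_nonneg: "0 \<le> s x" for x
      unfolding s_def by (intro sum_nonneg) simp
    have normalized: "s x \<le> a powr p" if "lq_norm q x \<le> a" for x a
    proof -
      have "s x = (s x powr (1 / p)) powr p"
        using p s_nonneg by (simp add: powr_powr)
      also have "\<dots> \<le> a powr p"
        using that p by (intro powr_mono2) (auto simp: lq)
      finally show ?thesis .
    qed
    have bound: "lq_norm q ((1 - t) *\<^sub>R x + t *\<^sub>R y) \<le> (1 - t) * a + t * b"
      if "lq_norm q x \<le> a" "lq_norm q y \<le> b" "0 < a" "0 < b" for a b
    proof -
      define M where "M = (1 - t) * a + t * b"
      have M: "0 < M"
        unfolding M_def using t that by (intro add_pos_pos) auto
      \<comment> \<open>With this weight, (1 - t) x + t y equals \<open>M\<close> times the convex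
        combination of x/a and y/b with weights \<open>1 - r\<close> and \<open>r\<close>.\<close>
      define r where "r = t * b / M"
      have r: "0 \<le> r" "r \<le> 1" and r1: "1 - r = (1 - t) * a / M"
        using M t that by (auto simp: r_def M_def field_simps)
      have term_le: "\<bar>((1 - t) *\<^sub>R x + t *\<^sub>R y) $ i\<bar> powr p
          \<le> M powr p * ((1 - r) * (\<bar>x $ i\<bar> powr p / a powr p) + r * (\<bar>y $ i\<bar> powr p / b powr p))" for i
      proof -
        have "\<bar>((1 - t) *\<^sub>R x + t *\<^sub>R y) $ i\<bar> \<le> (1 - t) * \<bar>x $ i\<bar> + t * \<bar>y $ i\<bar>"
          using t abs_triangle_ineq[of "(1 - t) * x $ i" "t * y $ i"] by (simp add: abs_mult)
        also have "\<dots> = M * ((1 - r) * (\<bar>x $ i\<bar> / a) + r * (\<bar>y $ i\<bar> / b))"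
          unfolding r1 using M that by (simp add: r_def field_simps)
        finally have "\<bar>((1 - t) *\<^sub>R x + t *\<^sub>R y) $ i\<bar> powr p
            \<le> (M * ((1 - r) * (\<bar>x $ i\<bar> / a) + r * (\<bar>y $ i\<bar> / b))) powr p"
          using p by (intro powr_mono2) auto
        also have "\<dots> = M powr p * ((1 - r) * (\<bar>x $ i\<bar> / a) + r * (\<bar>y $ i\<bar> / b)) powr p"
          by (rule powr_mult)
        also have "\<dots> \<le> M powr p * ((1 - r) * (\<bar>x $ i\<bar> / a) powr p + r * (\<bar>y $ i\<bar> / b) powr p)"
          using convex_onD[OF powr_convex_nonneg[OF p], of r "\<bar>x $ i\<bar> / a" "\<bar>y $ i\<bar> / b"] r that
          by (intro mult_left_mono) auto
        finally show ?thesis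
          using that by (simp add: powr_divide)
      qed
      have "s ((1 - t) *\<^sub>R x + t *\<^sub>R y)
          \<le> (\<Sum>i\<in>UNIV. M powr p * ((1 - r) * (\<bar>x $ i\<bar> powr p / a powr p) + r * (\<bar>y $ i\<bar> powr p / b powr p)))"
        unfolding s_def by (intro sum_mono term_le)
      also have "\<dots> = M powr p * ((1 - r) * (s x / a powr p) + r * (s y / b powr p))"
        by (simp add: s_def sum_distrib_left[symmetric] sum.distrib sum_divide_distrib[symmetric])
      also have "\<dots> \<le> M powr p * ((1 - r) * 1 + r * 1)"
        using normalized that r by (intro mult_left_mono add_mono) (auto simp: divide_le_eq)
      finally have "s ((1 - t) *\<^sub>R x + t *\<^sub>R y) powr (1 / p) \<le> (M powr p) powr (1 / p)"
        using p s_nonneg by (intro powr_mono2) auto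
      then show ?thesis
        using p M by (simp add: lq powr_powr M_def)
    qed
    show ?thesis
    proof (rule field_le_epsilon)
      \<comment> \<open>The slack \<open>e\<close> keeps both bounds positive even when a norm
        vanishes; since the weights sum to 1, it enters the result once.\<close>
      fix e :: real assume "0 < e"
      then show "lq_norm q ((1 - t) *\<^sub>R x + t *\<^sub>R y) \<le> (1 - t) * lq_norm q x + t * lq_norm q y + e"
        using bound[of "lq_norm q x + e" "lq_norm q y + e"] lq_norm_nonneg[of x] lq_norm_nonneg[of y]
        by (simp add: algebra_simps)
    qed
  qed
qed simp

lemma continuous_on_lq_norm: "continuous_on S (lq_norm q :: real ^ 'm \<Rightarrow> real)"
  using convex_on_continuous[OF open_UNIV convex_lq_norm] continuous_on_subset by blast

end

section \<open>Coordinates and finite supports of square-summable families\<close>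

lemma bounded_linear_ell2_nth: "bounded_linear (\<lambda>x. ell2_nth x l)"
  by (rule bounded_linear_intro[of _ 1]) (auto intro: ell2_norm_nth_le)

text \<open>Any \<open>n\<close> such coordinates contribute at least \<open>n\<close> times
  \<open>e\<^sup>2\<close> to the squared norm, which bounds \<open>n\<close>.\<close>

lemma finite_norm_ell2_nth_ge:
  assumes "0 < e"
  shows "finite {l. e \<le> norm (ell2_nth x l)}"
proof (rule ccontr)
  assume "infinite {l. e \<le> norm (ell2_nth x l)}"
  moreover obtain n :: nat where n: "(norm x)\<^sup>2 / e\<^sup>2 < real n"
    using reals_Archimedean2 by blast
  ultimately obtain F where F: "finite F" "card F = n" "F \<subseteq> {l. e \<le> norm (ell2_nth x l)}"
    using infinite_arbitrarily_large by blast
  have "real n * e\<^sup>2 = (\<Sum>l\<in>F. e\<^sup>2)"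
    using F by simp
  also have "\<dots> \<le> (\<Sum>l\<in>F. (norm (ell2_nth x l))\<^sup>2)"
    using F assms by (intro sum_mono power_mono) auto
  also have "\<dots> \<le> (norm x)\<^sup>2"
    by (rule ell2_sum_le_norm_power2[OF F(1)])
  finally show False
    using n assms by (simp add: field_simps)
qed

lemma ell2_norm_power2_finite_support:
  assumes "finite F" "\<And>l. l \<notin> F \<Longrightarrow> ell2_nth x l = 0"
  shows "(norm x)\<^sup>2 = (\<Sum>l\<in>F. (norm (ell2_nth x l))\<^sup>2)"
proof -
  have "(\<Sum>\<^sub>\<infinity>l. (norm (ell2_nth x l))\<^sup>2) = (\<Sum>\<^sub>\<infinity>l\<in>F. (norm (ell2_nth x l))\<^sup>2)"
    using assms by (intro infsum_cong_neutral) auto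
  then show ?thesis
    using assms by (simp add: ell2_norm_power2)
qed

text \<open>Provides the competitor for the thresholding estimate: \<open>y - x\<close> lives on the
  single index \<open>l\<close>, so inner products with it collapse to one term.\<close>

lemma ell2_zero_coordinate:
  fixes x :: "('l, 'b::real_inner) ell2"
  obtains y where "ell2_nth y = (ell2_nth x)(l := 0)" "\<And>a. inner a (y - x) = - inner (ell2_nth a l) (ell2_nth x l)"
proof -
  have "(\<lambda>k. (norm (((ell2_nth x)(l := 0)) k))\<^sup>2) summable_on UNIV"
    by (rule summable_on_comparison_test[OF ell2_summable[of x]]) auto
  then have y: "ell2_nth (ell2_abs ((ell2_nth x)(l := 0))) = (ell2_nth x)(l := 0)"
    by (simp add: ell2_abs_inverse)
  have "inner a (ell2_abs ((ell2_nth x)(l := 0)) - x) = - inner (ell2_nth a l) (ell2_nth x l)" for a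
  proof -
    have "inner a (ell2_abs ((ell2_nth x)(l := 0)) - x)
        = (\<Sum>\<^sub>\<infinity>k\<in>{l}. inner (ell2_nth a k) (ell2_nth (ell2_abs ((ell2_nth x)(l := 0)) - x) k))"
      unfolding inner_ell2_def by (intro infsum_cong_neutral) (auto simp: y)
    then show ?thesis
      by (simp add: y)
  qed
  with y show ?thesis
    by (rule that)
qed

text \<open>Refine the subsequence once for each index; coordinates that already converge keep
  converging.\<close>

lemma coordinates_convergent_subseq:
  fixes f :: "nat \<Rightarrow> 'l \<Rightarrow> 'b::heine_borel"
  assumes "finite F" "\<And>l. l \<in> F \<Longrightarrow> bounded (range (\<lambda>n. f n l))"
  shows "\<exists>r. strict_mono r \<and> (\<forall>l\<in>F. convergent (\<lambda>n. f (r n) l))"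
  using assms
proof (induction F)
  case empty
  show ?case
    using strict_mono_id by blast
next
  case (insert k F)
  then obtain r where r: "strict_mono r" "\<And>l. l \<in> F \<Longrightarrow> convergent (\<lambda>n. f (r n) l)"
    by blast
  have "bounded (range (\<lambda>n. f (r n) k))"
    by (rule bounded_subset[OF insert.prems[of k]]) auto
  then obtain a s where s: "strict_mono s" "((\<lambda>n. f (r n) k) \<circ> s) \<longlonglongrightarrow> a"
    using bounded_imp_convergent_subsequence by blast
  have "convergent (\<lambda>n. f ((r \<circ> s) n) l)" if "l \<in> insert k F" for l
  proof (cases "l = k")
    case True
    then show ?thesis
      using s(2) by (auto simp: o_def convergent_def)
  next
    case False
    then show ?thesis
      using that convergent_subseq_convergent[OF r(2) s(1), of l] by (simp add: o_def)
  qed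
  then show ?case
    using strict_mono_o[OF r(1) s(1)] by blast
qed

text \<open>Bolzano-Weierstrass: once the supports lie in \<open>F\<close>, the norm is a finite sum
  over \<open>F\<close>, so convergence of the coordinates in \<open>F\<close> is convergence in
  norm.\<close>

lemma ell2_bounded_finite_support_convergent_subseq:
  fixes u :: "nat \<Rightarrow> ('l, 'b::euclidean_space) ell2"
  assumes bd: "bounded (range u)" and F: "finite F"
    and supp: "\<forall>\<^sub>F n in sequentially. \<forall>l. l \<notin> F \<longrightarrow> ell2_nth (u n) l = 0"
  shows "\<exists>r w. strict_mono r \<and> (u \<circ> r) \<longlonglongrightarrow> w"
proof -
  have "bounded (range (\<lambda>n. ell2_nth (u n) l))" for l
    using bounded_linear_image[OF bd bounded_linear_ell2_nth] by (simp add: image_image)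
  then obtain r where r: "strict_mono r" "\<And>l. l \<in> F \<Longrightarrow> convergent (\<lambda>n. ell2_nth (u (r n)) l)"
    using coordinates_convergent_subseq[OF F, of "\<lambda>n. ell2_nth (u n)"] by blast
  then obtain f where f: "\<And>l. l \<in> F \<Longrightarrow> (\<lambda>n. ell2_nth (u (r n)) l) \<longlonglongrightarrow> f l"
    unfolding convergent_def by metis
  define h where "h l = (if l \<in> F then f l else 0)" for l
  have "(\<lambda>l. (norm (h l))\<^sup>2) summable_on F"
    using F by simp
  then have "(\<lambda>l. (norm (h l))\<^sup>2) summable_on UNIV"
    by (rule summable_on_cong_neutral[THEN iffD1, rotated -1]) (auto simp: h_def)
  then have h: "ell2_nth (ell2_abs h) = h"
    by (simp add: ell2_abs_inverse)
  have "(\<lambda>n. \<Sum>l\<in>F. (norm (ell2_nth (u (r n)) l - f l))\<^sup>2) \<longlonglongrightarrow> (\<Sum>l\<in>F. (norm (f l - f l))\<^sup>2)"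
    by (intro tendsto_intros f)
  then have lim: "(\<lambda>n. \<Sum>l\<in>F. (norm (ell2_nth (u (r n)) l - f l))\<^sup>2) \<longlonglongrightarrow> 0"
    by simp
  have "\<forall>\<^sub>F n in sequentially. \<forall>l. l \<notin> F \<longrightarrow> ell2_nth (u (r n)) l = 0"
    using eventually_subseq[OF r(1) supp] .
  then have "\<forall>\<^sub>F n in sequentially. (\<Sum>l\<in>F. (norm (ell2_nth (u (r n)) l - f l))\<^sup>2)
      = (norm (u (r n) - ell2_abs h))\<^sup>2"
  proof eventually_elim
    case (elim n)
    then have "(norm (u (r n) - ell2_abs h))\<^sup>2 = (\<Sum>l\<in>F. (norm (ell2_nth (u (r n) - ell2_abs h) l))\<^sup>2)"
      by (intro ell2_norm_power2_finite_support F) (simp add: h h_def)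
    then show ?case
      by (simp add: h h_def)
  qed
  then have "(\<lambda>n. (norm (u (r n) - ell2_abs h))\<^sup>2) \<longlonglongrightarrow> 0"
    by (rule Lim_transform_eventually[OF lim])
  then have "(u \<circ> r) \<longlonglongrightarrow> ell2_abs h"
    unfolding o_def by (rule LIM_zero_cancel[OF tendsto_0_if_norm_power2])
  with r(1) show ?thesis by blast
qed

section \<open>The weighted penalty\<close>

text \<open>The last parameter only fixes the dimension \<open>'m\<close>.\<close>

locale weighted_penalty =
  fixes q :: ennreal and v \<omega> :: "'l \<Rightarrow> real" and mty :: "'m::finite itself"
  assumes q: "1 \<le> q" and v: "\<And>l. 0 \<le> v l" and \<omega>: "\<And>l. 0 \<le> \<omega> l"
begin

definition rho :: "'l \<Rightarrow> real ^ 'm \<Rightarrow> real"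
  where "rho l x = v l * lq_norm q x + \<omega> l * (norm x)\<^sup>2"

lemma rho_nonneg: "0 \<le> rho l x"
  by (simp add: rho_def v \<omega> lq_norm_nonneg[OF q])

lemma continuous_on_rho: "continuous_on S (rho l)"
  unfolding rho_def by (intro continuous_intros continuous_on_lq_norm[OF q])

lemma rho_convex:
  assumes "0 \<le> t" "t \<le> 1"
  shows "rho l ((1 - t) *\<^sub>R x + t *\<^sub>R y) \<le> (1 - t) * rho l x + t * rho l y"
proof -
  have "lq_norm q ((1 - t) *\<^sub>R x + t *\<^sub>R y) \<le> (1 - t) * lq_norm q x + t * lq_norm q y"
    using convex_onD[OF convex_lq_norm[OF q], of t x y] assms by simp
  then have "v l * lq_norm q ((1 - t) *\<^sub>R x + t *\<^sub>R y) \<le> v l * ((1 - t) * lq_norm q x + t * lq_norm q y)"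
    by (rule mult_left_mono[OF _ v])
  moreover have "\<omega> l * (norm ((1 - t) *\<^sub>R x + t *\<^sub>R y))\<^sup>2 \<le> \<omega> l * ((1 - t) * (norm x)\<^sup>2 + t * (norm y)\<^sup>2)"
    by (rule mult_left_mono[OF convex_norm_power2_le[OF assms] \<omega>])
  ultimately show ?thesis
    by (simp add: rho_def algebra_simps)
qed

text \<open>A sum in \<open>ennreal\<close> is the supremum of its finite subsums. Bounds on
  \<open>Psi\<close> thus become bounds on finite real sums, which pass easily through convex
  combinations and limits.\<close>

lemma Psi_le_iff_finite_sums:
  fixes x :: "('l, real ^ 'm) ell2"
  assumes "0 \<le> a"
  shows "Psi q v \<omega> x \<le> ennreal a \<longleftrightarrow> (\<forall>F. finite F \<longrightarrow> (\<Sum>l\<in>F. rho l (ell2_nth x l)) \<le> a)"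
proof -
  have "Psi q v \<omega> x = (\<Sum>\<^sub>\<infinity>l. ennreal (v l * lq_norm q (ell2_nth x l)) + ennreal (\<omega> l * (norm (ell2_nth x l))\<^sup>2))"
    unfolding Psi_def by (intro infsum_add[symmetric] nonneg_summable_on_complete) auto
  also have "\<dots> = (\<Sum>\<^sub>\<infinity>l. ennreal (rho l (ell2_nth x l)))"
    unfolding rho_def
    by (intro infsum_cong ennreal_plus[symmetric] mult_nonneg_nonneg v \<omega> lq_norm_nonneg[OF q]) auto
  also have "\<dots> = (SUP F\<in>{F. finite F}. \<Sum>l\<in>F. ennreal (rho l (ell2_nth x l)))"
    by (subst nonneg_infsum_complete) auto
  also have "\<dots> = (SUP F\<in>{F. finite F}. ennreal (\<Sum>l\<in>F. rho l (ell2_nth x l)))"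
    by (simp add: sum_ennreal rho_nonneg)
  finally show ?thesis
    using assms by (auto simp: SUP_le_iff ennreal_le_iff)
qed

end

sublocale weighted_penalty \<subseteq> convex_penalty "Psi q v \<omega> :: ('l, real ^ 'm) ell2 \<Rightarrow> ennreal"
proof
  show "Psi q v \<omega> (0 :: ('l, real ^ 'm) ell2) = 0"
    by (simp add: Psi_def lq_norm_zero[OF q])
next
  fix x y :: "('l, real ^ 'm) ell2" and a b t :: real
  assume *: "Psi q v \<omega> x \<le> ennreal a" "Psi q v \<omega> y \<le> ennreal b" "0 \<le> a" "0 \<le> b" "0 \<le> t" "t \<le> 1"
  have "0 \<le> (1 - t) * a + t * b"
    using * by simp
  moreover have "(\<Sum>l\<in>F. rho l (ell2_nth ((1 - t) *\<^sub>R x + t *\<^sub>R y) l)) \<le> (1 - t) * a + t * b"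
    if "finite F" for F
  proof -
    have "(\<Sum>l\<in>F. rho l (ell2_nth ((1 - t) *\<^sub>R x + t *\<^sub>R y) l))
        \<le> (\<Sum>l\<in>F. (1 - t) * rho l (ell2_nth x l) + t * rho l (ell2_nth y l))"
      unfolding ell2_nth_add ell2_nth_scaleR using * by (intro sum_mono rho_convex) auto
    also have "\<dots> = (1 - t) * (\<Sum>l\<in>F. rho l (ell2_nth x l)) + t * (\<Sum>l\<in>F. rho l (ell2_nth y l))"
      by (simp add: sum.distrib sum_distrib_left)
    also have "\<dots> \<le> (1 - t) * a + t * b"
      using * that by (intro add_mono mult_left_mono) (auto simp: Psi_le_iff_finite_sums)
    finally show ?thesis .
  qed
  ultimately show "Psi q v \<omega> ((1 - t) *\<^sub>R x + t *\<^sub>R y) \<le> ennreal ((1 - t) * a + t * b)"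
    by (simp only: Psi_le_iff_finite_sums) blast
next
  fix a :: real assume "0 \<le> a"
  then have "{x :: ('l, real ^ 'm) ell2. Psi q v \<omega> x \<le> ennreal a}
      = (\<Inter>F\<in>{F. finite F}. {x. (\<Sum>l\<in>F. rho l (ell2_nth x l)) \<le> a})"
    by (auto simp: Psi_le_iff_finite_sums)
  \<comment> \<open>Each finite sum depends continuously on finitely many coordinates.\<close>
  also have "closed \<dots>"
    by (intro closed_INT ballI closed_Collect_le continuous_intros
        continuous_on_compose2[OF continuous_on_rho[of UNIV] linear_continuous_on[OF bounded_linear_ell2_nth]]) auto
  finally show "closed {x :: ('l, real ^ 'm) ell2. Psi q v \<omega> x \<le> ennreal a}" .
qed

section \<open>Thresholding, coercivity and the operator \<open>U\<close>\<close>

context weighted_penalty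
begin

lemma sum_rho_le_psi:
  fixes x :: "('l, real ^ 'm) ell2"
  assumes "x \<in> D" "finite F"
  shows "(\<Sum>l\<in>F. rho l (ell2_nth x l)) \<le> psi x"
  using assms P_le_iff[of "psi x" x] Psi_le_iff_finite_sums[of "psi x" x] by simp

lemma in_D_psi_le:
  fixes x :: "('l, real ^ 'm) ell2"
  assumes "0 \<le> a" "\<And>F. finite F \<Longrightarrow> (\<Sum>l\<in>F. rho l (ell2_nth x l)) \<le> a"
  shows "x \<in> D" "psi x \<le> a"
  using assms P_le_iff[of a x] Psi_le_iff_finite_sums[of a x] by simp_all

text \<open>Soft thresholding: comparison with the point whose \<open>l\<close>-th coordinate is deleted.\<close>

lemma is_min_id_coordinate_threshold:
  fixes z :: "('l, real ^ 'm) ell2"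
  assumes min: "is_min (\<lambda>x. x) a z" and nz: "ell2_nth z l \<noteq> 0"
  shows "v l / (2 * real CARD('m)) \<le> norm (ell2_nth (a - z) l)"
proof -
  have zD: "z \<in> D"
    by (rule is_min_id_variational(1)[OF min])
  obtain y where y: "ell2_nth y = (ell2_nth z)(l := 0)"
    and inner_y: "\<And>a. inner a (y - z) = - inner (ell2_nth a l) (ell2_nth z l)"
    using ell2_zero_coordinate[of z l] by blast
  \<comment> \<open>Deleting coordinate \<open>l\<close> lowers the penalty by at least
    \<open>rho l (ell2_nth z l)\<close>. Inserting \<open>l\<close> into \<open>F\<close> ensures
    that this term is present before it is subtracted.\<close>
  have sums: "(\<Sum>k\<in>F. rho k (ell2_nth y k)) \<le> psi z - rho l (ell2_nth z l)" if "finite F" for F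
  proof -
    have "rho l 0 = 0"
      by (simp add: rho_def lq_norm_zero[OF q])
    then have "(\<Sum>k\<in>F. rho k (ell2_nth y k)) = (\<Sum>k\<in>F - {l}. rho k (ell2_nth z k))"
      by (intro sum.mono_neutral_cong_right that) (auto simp: y)
    also have "\<dots> = (\<Sum>k\<in>insert l F. rho k (ell2_nth z k)) - rho l (ell2_nth z l)"
      using that by (simp add: sum.insert_remove)
    also have "\<dots> \<le> psi z - rho l (ell2_nth z l)"
      using sum_rho_le_psi[OF zD, of "insert l F"] that by simp
    finally show ?thesis .
  qed
  have "0 \<le> psi z - rho l (ell2_nth z l)"
    using sums[of "{}"] by simp
  note y_le = in_D_psi_le[OF this sums]
  define n where "n = norm (ell2_nth z l)"
  have n: "0 < n"
    using nz by (simp add: n_def)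
  \<comment> \<open>The drop in penalty is at most twice the inner product of the
    \<open>l\<close>-th coordinates of \<open>a - z\<close> and \<open>z\<close>. Both ends of the
    chain carry the factor \<open>n\<close>, which is cancelled last.\<close>
  have "v l * (n / real CARD('m)) \<le> v l * lq_norm q (ell2_nth z l)"
    using norm_le_card_lq_norm[OF q, of "ell2_nth z l"]
    by (intro mult_left_mono v) (simp add: n_def divide_le_eq mult.commute)
  also have "\<dots> \<le> rho l (ell2_nth z l)"
    by (simp add: rho_def \<omega>)
  also have "\<dots> \<le> 2 * inner (ell2_nth (a - z) l) (ell2_nth z l)"
    using is_min_id_variational(2)[OF min y_le(1)] y_le(2) by (simp add: inner_y)
  also have "\<dots> \<le> 2 * (norm (ell2_nth (a - z) l) * n)"
    using norm_cauchy_schwarz[of "ell2_nth (a - z) l" "ell2_nth z l"] by (simp add: n_def)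
  finally have "v l / (2 * real CARD('m)) * n \<le> norm (ell2_nth (a - z) l) * n"
    by (simp add: field_simps)
  then show ?thesis
    by (rule mult_right_le_imp_le[OF _ n])
qed

text \<open>Where \<open>v l < c\<close> the quadratic part of the penalty controls the squared
  norm. Elsewhere the first part controls the sum of the coordinate norms, which dominates the
  square root of the sum of their squares.\<close>

lemma bounded_sublevel:
  assumes "0 \<le> a" "0 < c" "finite {l. v l < c}" "0 < c'" "\<And>l. v l < c \<Longrightarrow> c' \<le> \<omega> l"
  shows "bounded {x :: ('l, real ^ 'm) ell2. Psi q v \<omega> x \<le> ennreal a}"
  unfolding bounded_iff
proof (intro exI ballI)
  fix x :: "('l, real ^ 'm) ell2"
  assume "x \<in> {x. Psi q v \<omega> x \<le> ennreal a}"
  then have x: "(\<Sum>l\<in>F. rho l (ell2_nth x l)) \<le> a" if "finite F" for F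
    using that \<open>0 \<le> a\<close> by (simp add: Psi_le_iff_finite_sums)
  define N where "N = real CARD('m)"
  have N: "0 < N"
    by (simp add: N_def)
  have "(norm x)\<^sup>2 \<le> a / c' + (a * N / c)\<^sup>2"
    unfolding ell2_norm_power2
  proof (rule infsum_le_finite_sums[OF ell2_summable])
    fix F :: "'l set" assume F: "finite F"
    define F1 where "F1 = F \<inter> {l. v l < c}"
    define F2 where "F2 = F - {l. v l < c}"
    have fin: "finite F1" "finite F2"
      using F by (auto simp: F1_def F2_def)
    have "(\<Sum>l\<in>F1. c' * (norm (ell2_nth x l))\<^sup>2) \<le> (\<Sum>l\<in>F1. rho l (ell2_nth x l))"
    proof (rule sum_mono)
      fix l assume "l \<in> F1"
      then have "c' * (norm (ell2_nth x l))\<^sup>2 \<le> \<omega> l * (norm (ell2_nth x l))\<^sup>2"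
        using assms(5) by (intro mult_right_mono) (auto simp: F1_def)
      moreover have "0 \<le> v l * lq_norm q (ell2_nth x l)"
        by (intro mult_nonneg_nonneg v lq_norm_nonneg[OF q])
      ultimately show "c' * (norm (ell2_nth x l))\<^sup>2 \<le> rho l (ell2_nth x l)"
        by (simp add: rho_def)
    qed
    then have S1: "(\<Sum>l\<in>F1. (norm (ell2_nth x l))\<^sup>2) \<le> a / c'"
      using x[OF fin(1)] \<open>0 < c'\<close> by (simp add: sum_distrib_left[symmetric] field_simps)
    have "(\<Sum>l\<in>F2. c / N * norm (ell2_nth x l)) \<le> (\<Sum>l\<in>F2. rho l (ell2_nth x l))"
    proof (rule sum_mono)
      fix l assume "l \<in> F2"
      have "c / N * norm (ell2_nth x l) \<le> c * lq_norm q (ell2_nth x l)"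
        using norm_le_card_lq_norm[OF q, of "ell2_nth x l"] \<open>0 < c\<close> N
        by (simp add: N_def field_simps)
      also have "\<dots> \<le> v l * lq_norm q (ell2_nth x l)"
        using \<open>l \<in> F2\<close> by (intro mult_right_mono lq_norm_nonneg[OF q]) (auto simp: F2_def)
      also have "\<dots> \<le> rho l (ell2_nth x l)"
        by (simp add: rho_def \<omega>)
      finally show "c / N * norm (ell2_nth x l) \<le> rho l (ell2_nth x l)" .
    qed
    then have "c / N * (\<Sum>l\<in>F2. norm (ell2_nth x l)) \<le> a"
      using x[OF fin(2)] by (simp add: sum_distrib_left)
    then have "(\<Sum>l\<in>F2. norm (ell2_nth x l)) \<le> a * N / c"
      using \<open>0 < c\<close> N by (simp add: field_simps)
    then have "L2_set (\<lambda>l. norm (ell2_nth x l)) F2 \<le> a * N / c"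
      using L2_set_le_sum[of F2 "\<lambda>l. norm (ell2_nth x l)"] by simp
    then have "(L2_set (\<lambda>l. norm (ell2_nth x l)) F2)\<^sup>2 \<le> (a * N / c)\<^sup>2"
      by (intro power_mono L2_set_nonneg)
    then have S2: "(\<Sum>l\<in>F2. (norm (ell2_nth x l))\<^sup>2) \<le> (a * N / c)\<^sup>2"
      by (simp add: L2_set_def sum_nonneg)
    have "(\<Sum>l\<in>F. (norm (ell2_nth x l))\<^sup>2)
        = (\<Sum>l\<in>F1. (norm (ell2_nth x l))\<^sup>2) + (\<Sum>l\<in>F2. (norm (ell2_nth x l))\<^sup>2)"
      using sum.Int_Diff[OF F, of _ "{l. v l < c}"] by (simp add: F1_def F2_def)
    with S1 S2 show "(\<Sum>l\<in>F. (norm (ell2_nth x l))\<^sup>2) \<le> a / c' + (a * N / c)\<^sup>2"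
      by linarith
  qed
  then show "norm x \<le> sqrt (a / c' + (a * N / c)\<^sup>2)"
    by (rule real_le_rsqrt)
qed

text \<open>\<open>ARG_MIN\<close> is a choice operator; existence of a minimizer is what makes its
  value one.\<close>

lemma is_min_U_op: "is_min (\<lambda>x. x) a (U_op q v \<omega> a :: ('l, real ^ 'm) ell2)"
proof -
  have eq: "(\<lambda>z. ennreal ((norm (a - z))\<^sup>2) + Psi q v \<omega> z) = objective (\<lambda>x. x) a"
    by (simp add: fun_eq_iff objective_def norm_minus_commute)
  show ?thesis
    unfolding U_op_def eq arg_min_def is_min_def
    by (rule someI_ex) (use ex_is_min_id[of a] in \<open>simp add: is_min_def\<close>)
qed

end

section \<open>Strong convergence\<close>

theorem proposition4p9:
  fixes q :: ennreal
    and v \<omega> :: "'l::countable \<Rightarrow> real"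
    and T :: "('l, real ^ 'm) ell2 \<Rightarrow> 'h::{real_inner, complete_space}"
    and g :: 'h
    and u :: "nat \<Rightarrow> ('l, real ^ 'm) ell2"
  assumes "separable_space (euclidean :: 'h topology)"
    and "bounded_linear T" and "onorm T < 1"
    and "\<And>l. 0 \<le> v l" and "\<And>l. 0 \<le> \<omega> l"
    and "strictly_convex (K_fun q v \<omega> T g)"
    and "1 \<le> q"
    and "bounded_away_from_0 v \<or> bounded_away_from_0 \<omega>"
    and "\<not> bounded_away_from_0 v \<Longrightarrow> \<exists>c>0. finite {l. v l < c}"
    and "\<And>m. u (Suc m) = U_op q v \<omega> (u m + adjoint T (g - T (u m)))"
  shows "\<exists>u'. is_arg_min (K_fun q v \<omega> T g) (\<lambda>_. True) u' \<and> u \<longlonglongrightarrow> u'"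
proof -
  interpret weighted_penalty q v \<omega> "TYPE('m)"
    by unfold_locales (use assms in auto)
  interpret forward_backward "Psi q v \<omega>" T g u
  proof (intro forward_backward.intro convex_penalty_axioms forward_backward_axioms.intro)
    show "is_min (\<lambda>x. x) (landweber T g (u m)) (u (Suc m))" for m
      unfolding assms(10) landweber_def by (rule is_min_U_op)
  qed (use assms(2,3) in simp_all)
  have K: "K_fun q v \<omega> T g = objective T g"
    by (simp add: fun_eq_iff K_fun_def objective_def)
  \<comment> \<open>Merges the two alternatives. If \<open>v\<close> is bounded away from 0, no
    index satisfies \<open>v l < c\<close> and \<open>c' = 1\<close> is arbitrary; otherwise
    \<open>c'\<close> is a lower bound of \<open>\<omega>\<close>.\<close>
  obtain c c' where c: "0 < c" "finite {l. v l < c}" "0 < c'" "\<And>l. v l < c \<Longrightarrow> c' \<le> \<omega> l"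
  proof (cases "bounded_away_from_0 v")
    case True
    then obtain c where "0 < c" "\<And>l. c \<le> v l"
      by (auto simp: bounded_away_from_0_def)
    then show ?thesis
      by (intro that[of c 1]) (auto simp: not_less[symmetric])
  next
    case False
    then show ?thesis
      using assms(8,9) that by (auto simp: bounded_away_from_0_def)
  qed
  have "\<exists>z. is_min T g z"
  proof (rule ex_is_min[OF T])
    fix a :: real assume a: "0 \<le> a"
    show "bounded {x. objective T g x \<le> ennreal a}"
    proof (rule bounded_subset[OF bounded_sublevel[OF a c]])
      show "{x. objective T g x \<le> ennreal a} \<subseteq> {x. Psi q v \<omega> x \<le> ennreal a}"
        unfolding objective_def by (auto elim!: order_trans[rotated] intro: add_increasing)
    qed
  qed
  then obtain z where z: "is_min T g z" ..
  define s where "s = landweber T g z - z"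
  \<comment> \<open>Outside \<open>F\<close> the coordinate threshold is at least
    \<open>2 * e\<close>: one \<open>e\<close> pays for the distance of the residual to its limit
    \<open>s\<close>, the other for the coordinate of \<open>s\<close>.\<close>
  define e where "e = c / (4 * real CARD('m))"
  have e: "0 < e"
    using c(1) by (simp add: e_def)
  define F where "F = {l. v l < c} \<union> {l. e \<le> norm (ell2_nth s l)}"
  have F: "finite F"
    unfolding F_def using c(2) finite_norm_ell2_nth_ge[OF e] by blast
  have "\<forall>\<^sub>F m in sequentially. norm (landweber T g (u m) - landweber T g z - (u (Suc m) - z)) < e"
    using tendstoD[OF residuals_tendsto_0(1)[OF z] e] by simp
  then have "\<forall>\<^sub>F m in sequentially. \<forall>l. l \<notin> F \<longrightarrow> ell2_nth (u (Suc m)) l = 0"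
  proof eventually_elim
    case (elim m)
    define p where "p = landweber T g (u m) - u (Suc m)"
    have ps: "norm (p - s) < e"
      using elim by (simp add: p_def s_def algebra_simps)
    show ?case
    proof (intro allI impI, rule ccontr)
      fix l assume l: "l \<notin> F" and nz: "ell2_nth (u (Suc m)) l \<noteq> 0"
      have "2 * e \<le> v l / (2 * real CARD('m))"
        using l by (simp add: F_def e_def field_simps)
      also have "\<dots> \<le> norm (ell2_nth p l)"
        unfolding p_def by (rule is_min_id_coordinate_threshold[OF iter nz])
      also have "\<dots> \<le> norm (ell2_nth (p - s) l) + norm (ell2_nth s l)"
        using norm_triangle_ineq[of "ell2_nth (p - s) l" "ell2_nth s l"] by simp
      also have "\<dots> < e + e"
        using ell2_norm_nth_le[of "p - s" l] ps l by (intro add_strict_mono) (auto simp: F_def)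
      finally show False by simp
    qed
  qed
  \<comment> \<open>The threshold concerns the output of an iteration, hence \<open>Suc m\<close>;
    an eventual statement survives the shift.\<close>
  then have supp: "\<forall>\<^sub>F m in sequentially. \<forall>l. l \<notin> F \<longrightarrow> ell2_nth (u m) l = 0"
    by (rule eventually_sequentially_Suc[THEN iffD1])
  have "norm (u m) \<le> norm z + norm (u 0 - z)" for m
    using decseqD[OF decseq_norm_diff[OF z], of 0 m] norm_triangle_sub[of "u m" z] by simp
  then have "bounded (range u)"
    by (auto simp: bounded_iff)
  then obtain r w where "strict_mono r" "(u \<circ> r) \<longlonglongrightarrow> w"
    using ell2_bounded_finite_support_convergent_subseq[OF _ F supp] by blast
  then have "is_min T g w \<and> u \<longlonglongrightarrow> w"
    by (rule convergent_if_subseq[OF z])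
  then show ?thesis
    unfolding K is_min_def by blast
qed

end
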